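(* Consider the noisy GMM iterates for the quadratic function $f$ with Gaussian gradient noise as described in the context, and let $\theta>0$. The infinite-horizon entropic risk $r_{\sigma^2}(\theta)$ is finite if and only if $(\alpha,\beta,\gamma)\in\mathcal{F}_\theta$, and (when finite) it is given by $$r_{\sigma^2}(\theta)=-\frac{\sigma^2}{\theta}\sum_{i=1}^d\log\left(1-\frac{\theta}{2u_i}\right).$$
   Context: Let $0<\mu<L$ and let $f(x)=\frac12x^\top Qx+p^\top x+r$ on $\mathbb{R}^d$, where $Q$ is a symmetric matrix with eigenvalues $0<\mu=\lambda_1(Q)\le\dots\le\lambda_d(Q)=L$, $p\in\mathbb{R}^d$, $r\in\mathbb{R}$; $x_*$ is the unique minimizer of $f$. The noisy generalized momentum method (GMM) with parameters $\alpha>0$, $\beta,\gamma\ge0$ and deterministic initialization $x_0,x_{-1}\in\mathbb{R}^d$ is $$x_{k+1}=(1+\beta)x_k-\beta x_{k-1}-\alpha\left(\nabla f(y_k)+w_{k+1}\right),\qquad y_k=(1+\gamma)x_k-\gamma x_{k-1},\qquad k\ge 0.$$ Noise assumption: for each $k$, $w_{k+1}\sim\mathcal{N}(0,\sigma^2I_d)$ for some $\sigma>0$, and $w_{k+1}$ is independent of the $\sigma$-algebra $\mathcal{F}_k$ generated by $x_0,\dots,x_k$. For $i=1,\dots,d$: $c_i=(1+\beta)-\alpha(1+\gamma)\lambda_i(Q)$, $d_i=-(\beta-\alpha\gamma\lambda_i(Q))$, $u_i=\frac{(1+d_i)[(1-d_i)^2-c_i^2]}{\lambda_i(Q)(1-d_i)\alpha^2}$.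 The $\theta$-feasible set is $$\mathcal{F}_\theta=\left\{(\alpha,\beta,\gamma)\in\mathbb{R}_{++}\times\mathbb{R}_+\times\mathbb{R}_+ \;\middle|\; |c_i|<|1-d_i| \text{ and } \theta<2u_i\text{ for } i=1,\dots,d\right\},$$ where $\mathbb{R}_+$, $\mathbb{R}_{++}$ are the non-negative and the positive reals. Entropic risks ($\theta>0$): $r_{k,\sigma^2}(\theta)=\frac{2\sigma^2}{\theta}\log\mathbb{E}\left[e^{\frac{\theta}{2\sigma^2}(f(x_k)-f(x_* ))}\right]$ (possibly $+\infty$), and $r_{\sigma^2}(\theta)=\limsup_{k\to\infty}r_{k,\sigma^2}(\theta)$. *)

theory Defs
  imports "HOL-Probability.Probability" "HOL-Computational_Algebra.Polynomial"
begin

definition charpoly :: "real ^ 'n ^ 'n \<Rightarrow> real poly" where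
  "charpoly Q = det (\<chi> i j. (if i = j then [:0, 1:] else 0) - [:Q $ i $ j:])"

lemma poly_charpoly: "poly (charpoly Q) t = det (mat t - Q)"
  by (simp add: charpoly_def det_def poly_sum poly_prod mat_def if_distrib cong: if_cong prod.cong)
     (intro sum.cong arg_cong2[where f = "(*)"] prod.cong; simp add: sign_def)

(* The i-th smallest real eigenvalue of Q, i = 1, 2, ..., counted with multiplicity as a root of
   the characteristic polynomial. For symmetric Q all i in {1..CARD('n)} are meaningful. *)
definition eigval :: "real ^ 'n ^ 'n \<Rightarrow> nat \<Rightarrow> real" where
  "eigval Q i = sorted_list_of_multiset (proots (charpoly Q)) ! (i - 1)"

definition quad :: "real ^ 'n ^ 'n \<Rightarrow> real ^ 'n \<Rightarrow> real \<Rightarrow> real ^ 'n \<Rightarrow> real" where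
  "quad Q p r x = 1 / 2 * (x \<bullet> (Q *v x)) + p \<bullet> x + r"

definition gradient :: "('v::real_inner \<Rightarrow> real) \<Rightarrow> 'v \<Rightarrow> 'v" where
  "gradient f x = (THE D. GDERIV f x :> D)"

definition gaussian_density :: "real \<Rightarrow> real ^ 'n \<Rightarrow> real" where
  "gaussian_density \<sigma> v = exp (- (norm v)\<^sup>2 / (2 * \<sigma>\<^sup>2)) / sqrt (2 * pi * \<sigma>\<^sup>2) ^ CARD('n)"

definition noisy_gmm ::
  "'a measure \<Rightarrow> ('v::real_inner \<Rightarrow> real) \<Rightarrow> real \<Rightarrow> real \<Rightarrow> real \<Rightarrow> 'v \<Rightarrow> 'v
    \<Rightarrow> (nat \<Rightarrow> 'a \<Rightarrow> 'v) \<Rightarrow> (int \<Rightarrow> 'a \<Rightarrow> 'v) \<Rightarrow> bool" where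
  "noisy_gmm M f \<alpha> \<beta> \<gamma> x0 xm1 w x \<longleftrightarrow>
    (\<forall>\<omega>\<in>space M. x 0 \<omega> = x0 \<and> x (- 1) \<omega> = xm1 \<and>
      (\<forall>k::nat. x (int k + 1) \<omega> =
        (1 + \<beta>) *\<^sub>R x (int k) \<omega> - \<beta> *\<^sub>R x (int k - 1) \<omega>
        - \<alpha> *\<^sub>R (gradient f ((1 + \<gamma>) *\<^sub>R x (int k) \<omega> - \<gamma> *\<^sub>R x (int k - 1) \<omega>) + w (k + 1) \<omega>)))"

definition iterate_sigma_algebra ::
  "'a measure \<Rightarrow> (int \<Rightarrow> 'a \<Rightarrow> 'v::topological_space) \<Rightarrow> nat \<Rightarrow> 'a set set" where
  "iterate_sigma_algebra M x k =
    sigma_sets (space M) (\<Union>j\<in>{..k}. {x (int j) -` A \<inter> space M | A. A \<in> sets borel})"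

definition gaussian_noise ::
  "'a measure \<Rightarrow> real \<Rightarrow> (nat \<Rightarrow> 'a \<Rightarrow> real ^ 'n) \<Rightarrow> (int \<Rightarrow> 'a \<Rightarrow> real ^ 'n) \<Rightarrow> bool" where
  "gaussian_noise M \<sigma> w x \<longleftrightarrow>
    (\<forall>k. distributed M lborel (w (k + 1)) (\<lambda>v. ennreal (gaussian_density \<sigma> v)) \<and>
         prob_space.indep_set M
           {w (k + 1) -` A \<inter> space M | A. A \<in> sets borel} (iterate_sigma_algebra M x k))"

definition gmm_c :: "real ^ 'n ^ 'n \<Rightarrow> real \<Rightarrow> real \<Rightarrow> real \<Rightarrow> nat \<Rightarrow> real" where
  "gmm_c Q \<alpha> \<beta> \<gamma> i = (1 + \<beta>) - \<alpha> * (1 + \<gamma>) * eigval Q i"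

definition gmm_d :: "real ^ 'n ^ 'n \<Rightarrow> real \<Rightarrow> real \<Rightarrow> real \<Rightarrow> nat \<Rightarrow> real" where
  "gmm_d Q \<alpha> \<beta> \<gamma> i = - (\<beta> - \<alpha> * \<gamma> * eigval Q i)"

definition gmm_u :: "real ^ 'n ^ 'n \<Rightarrow> real \<Rightarrow> real \<Rightarrow> real \<Rightarrow> nat \<Rightarrow> real" where
  "gmm_u Q \<alpha> \<beta> \<gamma> i =
    (1 + gmm_d Q \<alpha> \<beta> \<gamma> i) * ((1 - gmm_d Q \<alpha> \<beta> \<gamma> i)\<^sup>2 - (gmm_c Q \<alpha> \<beta> \<gamma> i)\<^sup>2)
    / (eigval Q i * (1 - gmm_d Q \<alpha> \<beta> \<gamma> i) * \<alpha>\<^sup>2)"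

(* When 1 - gmm_d = 0, where gmm_u is a division by zero, the first condition already fails. *)
definition feasible_set :: "real ^ 'n ^ 'n \<Rightarrow> real \<Rightarrow> (real \<times> real \<times> real) set" where
  "feasible_set Q \<theta> = {(\<alpha>, \<beta>, \<gamma>). \<alpha> > 0 \<and> \<beta> \<ge> 0 \<and> \<gamma> \<ge> 0 \<and>
    (\<forall>i\<in>{1..CARD('n)}.
      \<bar>gmm_c Q \<alpha> \<beta> \<gamma> i\<bar> < \<bar>1 - gmm_d Q \<alpha> \<beta> \<gamma> i\<bar> \<and> \<theta> < 2 * gmm_u Q \<alpha> \<beta> \<gamma> i)}"

definition ln_ennreal :: "ennreal \<Rightarrow> ereal" where
  "ln_ennreal e = (if e = 0 then - \<infinity> else if e = \<infinity> then \<infinity> else ereal (ln (enn2real e)))"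

definition entropic_risk ::
  "'a measure \<Rightarrow> ('v \<Rightarrow> real) \<Rightarrow> 'v \<Rightarrow> real \<Rightarrow> (int \<Rightarrow> 'a \<Rightarrow> 'v) \<Rightarrow> real \<Rightarrow> nat \<Rightarrow> ereal" where
  "entropic_risk M f xstar \<sigma> x \<theta> k =
    ereal (2 * \<sigma>\<^sup>2 / \<theta>) *
    ln_ennreal (\<integral>\<^sup>+\<omega>. ennreal (exp (\<theta> / (2 * \<sigma>\<^sup>2) * (f (x (int k) \<omega>) - f xstar))) \<partial>M)"

definition entropic_risk_inf ::
  "'a measure \<Rightarrow> ('v \<Rightarrow> real) \<Rightarrow> 'v \<Rightarrow> real \<Rightarrow> (int \<Rightarrow> 'a \<Rightarrow> 'v) \<Rightarrow> real \<Rightarrow> ereal" where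
  "entropic_risk_inf M f xstar \<sigma> x \<theta> = limsup (entropic_risk M f xstar \<sigma> x \<theta>)"

end

theory Submission
  imports Defs
begin

text \<open>
In an orthonormal eigenbasis of \<open>Q\<close> the method splits into independent scalar recursions
\<open>z (k + 1) = c * z k + d * z (k - 1) - \<alpha> * \<eta> (k + 1)\<close> with normal noise \<open>\<eta>\<close>, one for each eigenvalue \<open>l\<close>, and
the excess risk is the sum of the terms \<open>l / 2 * z\<^sup>2\<close>. So \<open>z k\<close> is normal, and the expectation defining the
risk is a product of one-dimensional Gaussian integrals (\<open>gmm_expectation_product\<close>). With \<open>S k\<close> the sum
of the first \<open>k\<close> squares of the impulse response and \<open>\<rho> = \<theta> * l * \<alpha>\<^sup>2 / 2\<close>, such an integral equals
\<open>exp (b * m\<^sup>2 / (1 - \<rho> * S k)) / sqrt (1 - \<rho> * S k)\<close> when \<open>\<rho> * S k < 1\<close>, and is infinite otherwise; here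
\<open>m\<close> is the mean of \<open>z k\<close> and \<open>b \<ge> 0\<close>.

If the recursion is stable, then \<open>m\<close> tends to 0 and \<open>S k\<close> increases to \<open>stationary_variance c d\<close>, for which
\<open>\<rho> * stationary_variance c d = \<theta> / (2 * u)\<close>. If moreover \<open>\<theta> < 2 * u\<close>, the integrals are finite and converge
to \<open>1 / sqrt (1 - \<theta> / (2 * u))\<close>; taking logarithms gives the formula.

Conversely, if some mode is infeasible, its \<open>\<rho> * S k\<close> eventually exceeds every number below 1
(\<open>impulse_energy_reaches_threshold\<close>), because a bounded energy would force stability
(\<open>impulse_summable_imp_stable\<close>). That factor then diverges to infinity, while all the others are at least 1,
so the risk is infinite. The boundary case \<open>\<theta> = 2 * u\<close>, in which each single expectation may be finite, is
included here.

The independence assumption relates each noise vector to the earlier iterates only. Independence of the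
whole array of noise coordinates follows because the iterates reveal the earlier noise and because an
isotropic Gaussian vector has independent coordinates in every orthonormal basis
(\<open>indep_vars_adapted_gaussian_components\<close>).
\<close>

section \<open>Orthonormal eigenbases and the spectrum\<close>

lemma symmetric_matrix_inner:
  fixes Q :: "real ^ 'n ^ 'n"
  assumes "transpose Q = Q"
  shows "x \<bullet> (Q *v y) = (Q *v x) \<bullet> y"
  by (metis assms dot_lmul_matrix vector_transpose_matrix)

text \<open>
The orthogonal complement \<open>W\<close> of finitely many eigenvectors of a symmetric matrix is invariant
under it, so a maximizer \<open>v\<close> of the Rayleigh quotient on the unit sphere of \<open>W\<close> is a new eigenvector:
the residual \<open>g = Q v - m v\<close> again lies in \<open>W\<close>, and moving from \<open>v\<close> in direction \<open>g\<close> would increase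
the quotient to first order unless \<open>g = 0\<close>.
\<close>

lemma symmetric_matrix_orthonormal_eigenvector_extend:
  fixes Q :: "real ^ 'n ^ 'n"
  assumes sym: "transpose Q = Q"
    and eig: "\<forall>b\<in>B. \<exists>l. Q *v b = l *\<^sub>R b"
    and fin: "finite B" and card: "card B < CARD('n)"
  obtains v m where "norm v = 1" "Q *v v = m *\<^sub>R v" "\<forall>b\<in>B. v \<bullet> b = 0"
proof -
  define W where "W = {y. \<forall>b\<in>B. y \<bullet> b = 0}"
  have dim: "dim (span B) < DIM(real ^ 'n)"
    using dim_le_card'[OF fin] card by simp
  obtain x where x: "x \<noteq> 0" "x \<in> W"
  proof (rule orthogonal_to_subspace_exists)
    show "dim B < DIM(real ^ 'n)" using dim by simp
  qed (use that in \<open>auto simp: W_def orthogonal_def span_base\<close>)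
  have Wlin: "a *\<^sub>R y + b *\<^sub>R z \<in> W" if "y \<in> W" "z \<in> W" for a b y z
    using that by (auto simp: W_def inner_add_left)
  have WQ: "Q *v y \<in> W" if "y \<in> W" for y
    using that eig by (fastforce simp: W_def symmetric_matrix_inner[OF sym, symmetric])
  have "closed W"
    unfolding W_def Collect_ball_eq by (intro closed_INT ballI closed_Collect_eq continuous_intros)
  then have "compact (W \<inter> sphere 0 1)"
    by (intro closed_Int_compact) auto
  moreover have "(1 / norm x) *\<^sub>R x \<in> W \<inter> sphere 0 1"
    using x Wlin[of x x "1 / norm x" 0] by auto
  moreover have "continuous_on (W \<inter> sphere 0 1) (\<lambda>y. y \<bullet> (Q *v y))"
    by (intro continuous_intros linear_continuous_on matrix_vector_mul_bounded_linear)
  ultimately have "\<exists>v\<in>W \<inter> sphere 0 1. \<forall>y\<in>W \<inter> sphere 0 1. y \<bullet> (Q *v y) \<le> v \<bullet> (Q *v v)"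
    by (intro continuous_attains_sup) auto
  then obtain v where v: "v \<in> W" "norm v = 1"
    and vmax: "\<And>y. y \<in> W \<Longrightarrow> norm y = 1 \<Longrightarrow> y \<bullet> (Q *v y) \<le> v \<bullet> (Q *v v)"
    by auto
  define m where "m = v \<bullet> (Q *v v)"
  have ray: "y \<bullet> (Q *v y) \<le> m * (y \<bullet> y)" if "y \<in> W" for y
  proof (cases "y = 0")
    case False
    have "((1 / norm y) *\<^sub>R y) \<bullet> (Q *v ((1 / norm y) *\<^sub>R y)) \<le> m"
      unfolding m_def using that False Wlin[of y y "1 / norm y" 0] by (intro vmax) auto
    then have "(y \<bullet> (Q *v y)) / (norm y * norm y) \<le> m"
      by (simp add: matrix_vector_mult_scaleR)
    then show ?thesis
      using False by (simp add: divide_simps power2_norm_eq_inner[symmetric] power2_eq_square split: if_splits)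
  qed simp
  define g where "g = Q *v v - m *\<^sub>R v"
  have gW: "g \<in> W"
    using Wlin[OF WQ[OF v(1)] v(1), of 1 "- m"] by (simp add: g_def)
  define K where "K = m * (g \<bullet> g) - g \<bullet> (Q *v g)"
  have K0: "K \<ge> 0" using ray[OF gW] by (simp add: K_def)
  have pert: "2 * (g \<bullet> g) * t \<le> t\<^sup>2 * K" for t
  proof -
    have vv: "v \<bullet> v = 1" using v by (simp add: power2_norm_eq_inner[symmetric])
    have "(v + t *\<^sub>R g) \<bullet> (Q *v (v + t *\<^sub>R g)) = m + 2 * t * (g \<bullet> (Q *v v)) + t\<^sup>2 * (g \<bullet> (Q *v g))"
      using symmetric_matrix_inner[OF sym, of v g]
      by (simp add: m_def matrix_vector_right_distrib matrix_vector_mult_scaleR inner_add_left inner_add_right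
          power2_eq_square algebra_simps inner_commute)
    moreover have "m * ((v + t *\<^sub>R g) \<bullet> (v + t *\<^sub>R g)) = m + 2 * t * m * (g \<bullet> v) + t\<^sup>2 * m * (g \<bullet> g)"
      using inner_commute[of v g]
      by (simp add: inner_add_left inner_add_right power2_eq_square vv) (simp add: algebra_simps)
    moreover have "v + t *\<^sub>R g \<in> W" using Wlin[OF v(1) gW, of 1 t] by simp
    ultimately have "m + 2 * t * (g \<bullet> (Q *v v)) + t\<^sup>2 * (g \<bullet> (Q *v g))
        \<le> m + 2 * t * m * (g \<bullet> v) + t\<^sup>2 * m * (g \<bullet> g)"
      using ray[of "v + t *\<^sub>R g"] by metis
    moreover have "g \<bullet> (Q *v v) = g \<bullet> g + m * (g \<bullet> v)"
      by (subst (2) g_def) (simp add: inner_diff_right)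
    ultimately show ?thesis
      by (simp only: K_def) (simp add: algebra_simps)
  qed
  have "g = 0"
  proof (rule ccontr)
    assume "g \<noteq> 0"
    then have G: "g \<bullet> g > 0" by simp
    \<comment> \<open>Any \<open>t > 0\<close> with \<open>t * K < 2 * (g \<bullet> g)\<close> contradicts \<open>pert\<close>; adding 1 keeps the denominator nonzero.\<close>
    define t where "t = (g \<bullet> g) / (K + 1)"
    have t: "t > 0" using G K0 by (simp add: t_def)
    have "2 * (g \<bullet> g) \<le> t * K" using pert[of t] t by (simp add: power2_eq_square)
    also have "\<dots> < t * (K + 1)" using t by simp
    also have "\<dots> = g \<bullet> g" using K0 by (simp add: t_def)
    finally show False using G by simp
  qed
  then show thesis using that[of v m] v by (auto simp: g_def W_def)
qed

lemma symmetric_matrix_eigenbasis: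
  fixes Q :: "real ^ 'n ^ 'n"
  assumes sym: "transpose Q = Q"
  obtains e :: "'n \<Rightarrow> real ^ 'n" and l :: "'n \<Rightarrow> real"
  where "\<And>i j. e i \<bullet> e j = (if i = j then 1 else 0)" "\<And>i. Q *v e i = l i *\<^sub>R e i"
proof -
  define ok where "ok B \<longleftrightarrow> finite B \<and> (\<forall>b\<in>B. norm b = 1 \<and> (\<exists>l. Q *v b = l *\<^sub>R b))
    \<and> (\<forall>b\<in>B. \<forall>b'\<in>B. b \<noteq> b' \<longrightarrow> b \<bullet> b' = 0)" for B :: "(real ^ 'n) set"
  have "\<exists>B. ok B \<and> card B = k" if "k \<le> CARD('n)" for k
    using that
  proof (induction k)
    case 0
    show ?case by (intro exI[of _ "{}"]) (simp add: ok_def)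
  next
    case (Suc k)
    then obtain B where B: "ok B" "card B = k" by auto
    obtain v m where v: "norm v = 1" "Q *v v = m *\<^sub>R v" "\<forall>b\<in>B. v \<bullet> b = 0"
      using symmetric_matrix_orthonormal_eigenvector_extend[OF sym, of B] B Suc.prems by (auto simp: ok_def)
    have "v \<notin> B" using v by (metis norm_eq_1 zero_neq_one)
    then have "card (insert v B) = Suc k" using B by (simp add: ok_def)
    moreover have "ok (insert v B)" using B v by (auto simp: ok_def inner_commute)
    ultimately show ?case by blast
  qed
  then obtain B where B: "ok B" "card B = CARD('n)" by blast
  then obtain e where e: "bij_betw e (UNIV :: 'n set) B"
    by (metis finite_same_card_bij finite ok_def)
  have mem: "e i \<in> B" for i using e by (auto simp: bij_betw_def)
  have "\<forall>i. \<exists>l. Q *v e i = l *\<^sub>R e i" using mem B by (auto simp: ok_def)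
  then obtain l where l: "\<And>i. Q *v e i = l i *\<^sub>R e i" by metis
  show thesis
  proof (rule that[OF _ l])
    fix i j
    have "e i \<noteq> e j" if "i \<noteq> j" using e that by (auto simp: bij_betw_def inj_on_def)
    then show "e i \<bullet> e j = (if i = j then 1 else 0)"
      using mem B by (auto simp: ok_def norm_eq_1)
  qed
qed

text \<open>
With the eigenvectors as the columns of an orthogonal matrix \<open>P\<close>, conjugation by \<open>P\<close> turns
\<open>t - Q\<close> into a diagonal matrix without changing the determinant.
\<close>

lemma charpoly_eigenbasis:
  fixes Q :: "real ^ 'n ^ 'n" and e :: "'n \<Rightarrow> real ^ 'n"
  assumes on: "\<And>i j. e i \<bullet> e j = (if i = j then 1 else 0)"
    and eig: "\<And>i. Q *v e i = l i *\<^sub>R e i"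
  shows "charpoly Q = (\<Prod>i\<in>UNIV. [:- l i, 1:])"
proof -
  have "poly (charpoly Q) t = poly (\<Prod>i\<in>UNIV. [:- l i, 1:]) t" for t
  proof -
    define P where "P = (\<chi> i j. e j $ i)"
    have col: "column j P = e j" for j by (simp add: P_def column_def vec_eq_iff)
    have conj: "(transpose P ** (A ** P)) $ i $ j = e i \<bullet> (A *v e j)" for A i j
      by (simp add: matrix_matrix_mult_def matrix_vector_mult_def transpose_def P_def inner_vec_def)
    have "(transpose P ** (mat 1 ** P)) $ i $ j = mat 1 $ i $ j" for i j
      unfolding conj by (simp add: on) (simp add: mat_def)
    then have "transpose P ** (mat 1 ** P) = mat 1"
      by (simp only: vec_eq_iff) blast
    then have "det (transpose P) * det P = 1"
      by (metis det_I det_mul matrix_mul_lid)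
    then have "det (mat t - Q) = det (transpose P ** ((mat t - Q) ** P))"
      by (simp add: det_mul algebra_simps)
    also have "\<dots> = (\<Prod>i\<in>UNIV. (transpose P ** ((mat t - Q) ** P)) $ i $ i)"
    proof (rule det_diagonal)
      fix i j :: 'n assume "i \<noteq> j"
      have "(mat t :: real ^ 'n ^ 'n) *v e j = t *\<^sub>R e j"
        by (simp add: vec_eq_iff matrix_vector_mult_def mat_def if_distrib[of "\<lambda>a. a * _"] sum.delta cong: if_cong)
      then show "(transpose P ** ((mat t - Q) ** P)) $ i $ j = 0"
        using \<open>i \<noteq> j\<close> by (simp add: conj matrix_vector_mult_diff_rdistrib eig inner_diff_right on)
    qed
    also have "\<dots> = (\<Prod>i\<in>UNIV. t - l i)"
    proof (rule prod.cong[OF refl])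
      fix i
      have "(mat t :: real ^ 'n ^ 'n) *v e i = t *\<^sub>R e i"
        by (simp add: vec_eq_iff matrix_vector_mult_def mat_def if_distrib[of "\<lambda>a. a * _"] sum.delta cong: if_cong)
      then show "(transpose P ** ((mat t - Q) ** P)) $ i $ i = t - l i"
        by (simp add: conj matrix_vector_mult_diff_rdistrib eig inner_diff_right on)
    qed
    finally show ?thesis by (simp add: poly_charpoly poly_prod)
  qed
  then show ?thesis by (simp add: poly_eq_poly_eq_iff[symmetric] fun_eq_iff)
qed

text \<open>
The eigenvalues enter the theorem as sorted roots of the characteristic polynomial, whereas the
dynamics decouples along an eigenbasis. Since only symmetric expressions in the eigenvalues occur, it
is enough that the two enumerations agree as multisets.
\<close>

lemma eigval_eigenbasis:
  fixes Q :: "real ^ 'n ^ 'n" and e :: "'n \<Rightarrow> real ^ 'n"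
  assumes on: "\<And>i j. e i \<bullet> e j = (if i = j then 1 else 0)"
    and eig: "\<And>i. Q *v e i = l i *\<^sub>R e i"
  shows "image_mset (eigval Q) (mset_set {1..CARD('n)}) = image_mset l (mset_set UNIV)"
    and "\<And>i. eigval Q 1 \<le> l i"
proof -
  define xs where "xs = sorted_list_of_multiset (proots (charpoly Q))"
  have sum_single: "(\<Sum>i\<in>A. {#l i#}) = image_mset l (mset_set A)" if "finite A" for A
    using that by (induction A) auto
  have mset: "mset xs = image_mset l (mset_set UNIV)"
    by (simp add: xs_def charpoly_eigenbasis[OF assms] proots_prod sum_single)
  then have len: "length xs = CARD('n)" by (metis size_image_mset size_mset size_mset_set)
  have eigval: "eigval Q k = xs ! (k - 1)" for k by (simp add: eigval_def xs_def)
  have "map (eigval Q) [1..<Suc CARD('n)] = xs"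
    by (intro nth_equalityI) (auto simp: len eigval simp del: upt_Suc)
  then have "image_mset (eigval Q) (mset [1..<Suc CARD('n)]) = mset xs"
    by (metis mset_map)
  then show "image_mset (eigval Q) (mset_set {1..CARD('n)}) = image_mset l (mset_set UNIV)"
    using mset by (simp add: atLeastLessThanSuc_atLeastAtMost del: upt_Suc)
  fix i
  have "l i \<in># mset xs" by (simp add: mset)
  then have "l i \<in> set xs" by simp
  then obtain j where "j < length xs" "l i = xs ! j" by (auto simp: in_set_conv_nth)
  moreover have "sorted xs" by (simp add: xs_def)
  ultimately show "eigval Q 1 \<le> l i" by (simp add: eigval sorted_nth_mono)
qed

lemma mset_image_Ball_iff:
  assumes "image_mset f (mset_set A) = image_mset h (mset_set B)" "finite A" "finite B"
  shows "(\<forall>i\<in>A. R (f i)) \<longleftrightarrow> (\<forall>i\<in>B. R (h i))"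
proof -
  have "f ` A = h ` B" using arg_cong[OF assms(1), of set_mset] assms(2,3) by simp
  then have "(\<forall>y\<in>f ` A. R y) \<longleftrightarrow> (\<forall>y\<in>h ` B. R y)" by simp
  then show ?thesis by simp
qed

lemma mset_image_sum_eq:
  fixes g :: "'c \<Rightarrow> 'd :: comm_monoid_add"
  assumes "image_mset f (mset_set A) = image_mset h (mset_set B)"
  shows "(\<Sum>i\<in>A. g (f i)) = (\<Sum>i\<in>B. g (h i))"
  using arg_cong[OF assms, of "\<lambda>X. sum_mset (image_mset g X)"]
  by (simp add: sum_unfold_sum_mset multiset.map_comp comp_def)

section \<open>Impulse response of second-order linear recurrences\<close>

text \<open>
The response to a unit impulse of the recurrence \<open>a (n + 2) = c * a (n + 1) + d * a n\<close>, shifted by one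
so that the impulse sits at index 1.
\<close>

fun impulse :: "real \<Rightarrow> real \<Rightarrow> nat \<Rightarrow> real" where
  "impulse c d 0 = 0"
| "impulse c d (Suc 0) = 1"
| "impulse c d (Suc (Suc n)) = c * impulse c d (Suc n) + d * impulse c d n"

text \<open>
Variation of constants: initial values and perturbations all propagate through the impulse response.
\<close>

lemma recurrence_solution:
  fixes a u :: "nat \<Rightarrow> real"
  assumes rec: "\<And>n. a (Suc (Suc n)) = c * a (Suc n) + d * a n + u n"
  shows "a (Suc n) = impulse c d (Suc n) * a 1 + d * impulse c d n * a 0
    + (\<Sum>j<n. impulse c d (n - j) * u j)"
proof (induction n rule: less_induct)
  case (less n)
  show ?case
  proof (cases "n < 2")
    case True
    then have "n = 0 \<or> n = 1" by auto
    then show ?thesis using rec[of 0] by auto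
  next
    case False
    then obtain m where n: "n = Suc (Suc m)"
      by (metis One_nat_def Suc_1 lessI less_Suc_eq_0_disj not0_implies_Suc)
    have "(\<Sum>j<n. impulse c d (n - j) * u j)
      = (\<Sum>j<m. impulse c d (Suc (Suc (m - j))) * u j) + c * u m + u (Suc m)"
      by (simp add: n Suc_diff_le)
    also have "(\<Sum>j<m. impulse c d (Suc (Suc (m - j))) * u j)
      = c * (\<Sum>j<m. impulse c d (Suc m - j) * u j) + d * (\<Sum>j<m. impulse c d (m - j) * u j)"
      by (simp add: Suc_diff_le sum.distrib sum_distrib_left algebra_simps)
    finally show ?thesis
      using less[of "Suc m"] less[of m] rec[of "Suc m"] by (simp add: n algebra_simps)
  qed
qed

text \<open>
The quadratic form subtracted on the right is a Lyapunov function of the recurrence whose decrement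
in each step is exactly a multiple of \<open>(impulse c d (n + 1))\<^sup>2\<close>. As an identity in \<open>c\<close> and \<open>d\<close>, it
serves both to sum the energy of a stable response and to show that finite energy forces
stability.
\<close>

lemma impulse_energy_identity:
  "(1 + d) * ((1 - d)\<^sup>2 - c\<^sup>2) * (\<Sum>j<n. (impulse c d (Suc j))\<^sup>2)
   = (1 - d) - ((1 - d) * (impulse c d (Suc n))\<^sup>2 + 2 * c * d * impulse c d (Suc n) * impulse c d n
       + (1 - d) * d\<^sup>2 * (impulse c d n)\<^sup>2)"
  by (induction n) (simp_all add: algebra_simps power2_eq_square)

text \<open>
The Casorati determinant of the solution space is multiplied by \<open>- d\<close> in each step. Hence a response
that tends to zero has \<open>\<bar>d\<bar> < 1\<close>, even when the two characteristic roots coincide or are not real.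
\<close>

lemma impulse_casorati:
  "(impulse c d (Suc n))\<^sup>2 - impulse c d n * impulse c d (Suc (Suc n)) = (- d) ^ n"
proof (induction n)
  case (Suc n)
  have "(impulse c d (Suc (Suc n)))\<^sup>2 - impulse c d (Suc n) * impulse c d (Suc (Suc (Suc n)))
     = - d * ((impulse c d (Suc n))\<^sup>2 - impulse c d n * impulse c d (Suc (Suc n)))"
    by (simp add: algebra_simps power2_eq_square)
  then show ?case using Suc by simp
qed simp

text \<open>
For stable coefficients, the variance of the stationary autoregressive process of order two with coefficients \<open>c\<close> and \<open>d\<close>
driven by unit white noise.
\<close>

definition stationary_variance :: "real \<Rightarrow> real \<Rightarrow> real" where
  "stationary_variance c d = (1 - d) / ((1 + d) * ((1 - d)\<^sup>2 - c\<^sup>2))"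

text \<open>
In the triangle \<open>\<bar>d\<bar> < 1\<close>, \<open>\<bar>c\<bar> < 1 - d\<close> of the coefficient plane the Lyapunov form is nonnegative,
so the energy identity bounds the partial sums; then the response tends to zero, the form vanishes in
the limit, and the identity evaluates the series.
\<close>

lemma stable_imp_impulse_sums:
  assumes d: "\<bar>d\<bar> < 1" and c: "\<bar>c\<bar> < 1 - d"
  shows "(\<lambda>j. (impulse c d (Suc j))\<^sup>2) sums stationary_variance c d"
    and "impulse c d \<longlonglongrightarrow> 0"
proof -
  define K where "K = (1 + d) * ((1 - d)\<^sup>2 - c\<^sup>2)"
  define E where "E n = (1 - d) * (impulse c d (Suc n))\<^sup>2 + 2 * c * d * impulse c d (Suc n) * impulse c d n
       + (1 - d) * d\<^sup>2 * (impulse c d n)\<^sup>2" for n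
  have "c\<^sup>2 < (1 - d)\<^sup>2" using c by (metis abs_ge_zero power2_abs power_strict_mono pos2)
  then have K: "K > 0" using d by (simp add: K_def)
  have E: "E n \<ge> 0" for n
  proof -
    \<comment> \<open>The form is \<open>(1 - d) * p\<^sup>2 + 2 * c * p * q + (1 - d) * q\<^sup>2\<close>, bounded below by \<open>(1 - d) * (\<bar>p\<bar> - \<bar>q\<bar>)\<^sup>2\<close>.\<close>
    define p q where "p = impulse c d (Suc n)" and "q = d * impulse c d n"
    have "\<bar>c * (p * q)\<bar> \<le> (1 - d) * (\<bar>p\<bar> * \<bar>q\<bar>)"
      using mult_right_mono[of "\<bar>c\<bar>" "1 - d" "\<bar>p\<bar> * \<bar>q\<bar>"] c by (simp add: abs_mult)
    then have "0 \<le> c * (p * q) + (1 - d) * (\<bar>p\<bar> * \<bar>q\<bar>)" by arith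
    moreover have "0 \<le> (1 - d) * (\<bar>p\<bar> - \<bar>q\<bar>)\<^sup>2" using d by simp
    ultimately have "0 \<le> (1 - d) * p\<^sup>2 + 2 * c * (p * q) + (1 - d) * q\<^sup>2"
      by (simp add: power2_diff algebra_simps)
    then show ?thesis
      by (simp add: E_def p_def q_def power_mult_distrib algebra_simps)
  qed
  have id: "K * (\<Sum>j<n. (impulse c d (Suc j))\<^sup>2) = (1 - d) - E n" for n
    using impulse_energy_identity[of d c n] by (simp add: K_def E_def)
  have "(\<Sum>j<n. (impulse c d (Suc j))\<^sup>2) \<le> (1 - d) / K" for n
    using id[of n] E[of n] K by (simp add: pos_le_divide_eq mult.commute)
  then have summ: "summable (\<lambda>j. (impulse c d (Suc j))\<^sup>2)"
    by (intro summableI_nonneg_bounded) auto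
  then have "(\<lambda>j. (impulse c d (Suc j))\<^sup>2) \<longlonglongrightarrow> 0" by (rule summable_LIMSEQ_zero)
  then have lim: "(\<lambda>j. impulse c d (Suc j)) \<longlonglongrightarrow> 0"
    by simp
  then show lim0: "impulse c d \<longlonglongrightarrow> 0" by (simp add: filterlim_sequentially_Suc)
  have "E \<longlonglongrightarrow> (1 - d) * 0\<^sup>2 + 2 * c * d * 0 * 0 + (1 - d) * d\<^sup>2 * 0\<^sup>2"
    unfolding E_def by (intro tendsto_intros lim lim0)
  then have "(\<lambda>n. ((1 - d) - E n) / K) \<longlonglongrightarrow> ((1 - d) - 0) / K"
    using K by (intro tendsto_intros) auto
  moreover have "(\<lambda>n. ((1 - d) - E n) / K) = (\<lambda>n. \<Sum>j<n. (impulse c d (Suc j))\<^sup>2)"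
    using K by (simp add: id[symmetric])
  ultimately show "(\<lambda>j. (impulse c d (Suc j))\<^sup>2) sums stationary_variance c d"
    by (simp add: sums_def stationary_variance_def K_def)
qed

text \<open>
The Casorati determinant gives \<open>\<bar>d\<bar> < 1\<close>. In the limit the energy identity then says that
\<open>(1 + d) * ((1 - d)\<^sup>2 - c\<^sup>2)\<close> times a nonnegative number equals \<open>1 - d > 0\<close>, which settles the sign of
\<open>(1 - d)\<^sup>2 - c\<^sup>2\<close>.
\<close>

lemma impulse_summable_imp_stable:
  assumes "summable (\<lambda>j. (impulse c d (Suc j))\<^sup>2)"
  shows "\<bar>d\<bar> < 1" "\<bar>c\<bar> < 1 - d"
proof -
  have "(\<lambda>j. (impulse c d (Suc j))\<^sup>2) \<longlonglongrightarrow> 0" using assms by (rule summable_LIMSEQ_zero)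
  then have lim1: "(\<lambda>j. impulse c d (Suc j)) \<longlonglongrightarrow> 0"
    by simp
  then have lim0: "impulse c d \<longlonglongrightarrow> 0" by (simp add: filterlim_sequentially_Suc)
  from lim1 have lim2: "(\<lambda>j. impulse c d (Suc (Suc j))) \<longlonglongrightarrow> 0"
    by (rule LIMSEQ_Suc)
  have "(\<lambda>n. (impulse c d (Suc n))\<^sup>2 - impulse c d n * impulse c d (Suc (Suc n))) \<longlonglongrightarrow> 0\<^sup>2 - 0 * 0"
    by (intro tendsto_intros lim0 lim1 lim2)
  then have "(\<lambda>n. (- d) ^ n) \<longlonglongrightarrow> 0" by (simp only: impulse_casorati) simp
  then have "(\<lambda>n. \<bar>d\<bar> ^ n) \<longlonglongrightarrow> 0" using tendsto_rabs_zero by (fastforce simp: power_abs)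
  then have "eventually (\<lambda>n. \<bar>d\<bar> ^ n < 1) sequentially" by (rule order_tendstoD) simp
  then show d: "\<bar>d\<bar> < 1"
    by (metis eventually_happens' one_le_power not_less sequentially_bot)
  define S where "S = (\<Sum>j. (impulse c d (Suc j))\<^sup>2)"
  have S: "S \<ge> 0" unfolding S_def by (intro suminf_nonneg assms) simp
  have "(\<lambda>n. (1 + d) * ((1 - d)\<^sup>2 - c\<^sup>2) * (\<Sum>j<n. (impulse c d (Suc j))\<^sup>2)) \<longlonglongrightarrow> (1 + d) * ((1 - d)\<^sup>2 - c\<^sup>2) * S"
    unfolding S_def by (intro tendsto_intros summable_LIMSEQ assms)
  moreover have "(\<lambda>n. (1 + d) * ((1 - d)\<^sup>2 - c\<^sup>2) * (\<Sum>j<n. (impulse c d (Suc j))\<^sup>2))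
      \<longlonglongrightarrow> (1 - d) - ((1 - d) * 0\<^sup>2 + 2 * c * d * 0 * 0 + (1 - d) * d\<^sup>2 * 0\<^sup>2)"
    unfolding impulse_energy_identity by (intro tendsto_intros lim0 lim1)
  ultimately have "(1 + d) * ((1 - d)\<^sup>2 - c\<^sup>2) * S = 1 - d"
    using LIMSEQ_unique by fastforce
  then have "(1 + d) * ((1 - d)\<^sup>2 - c\<^sup>2) * S > 0" using d by simp
  then have "(1 - d)\<^sup>2 - c\<^sup>2 > 0" using S d by (auto simp: zero_less_mult_iff)
  then show "\<bar>c\<bar> < 1 - d" using d power2_less_imp_less[of "\<bar>c\<bar>" "1 - d"] by simp
qed

text \<open>
The feasibility condition on a single eigenvalue \<open>l\<close> compares absolute values and therefore also
admits \<open>d > 1\<close> and \<open>d \<le> - 1\<close> in its first half. There \<open>u\<close> is not positive, so \<open>\<theta> < 2 * u\<close> excludes these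
cases, and what remains is the stability triangle together with a bound on the stationary variance.
\<close>

lemma mode_feasible_iff:
  fixes c d l \<alpha> \<theta> :: real
  assumes l: "l > 0" and \<alpha>: "\<alpha> > 0" and \<theta>: "\<theta> > 0"
  defines "u \<equiv> (1 + d) * ((1 - d)\<^sup>2 - c\<^sup>2) / (l * (1 - d) * \<alpha>\<^sup>2)"
    and "\<rho> \<equiv> \<theta> * l * \<alpha>\<^sup>2 / 2"
  shows "\<bar>c\<bar> < \<bar>1 - d\<bar> \<and> \<theta> < 2 * u \<longleftrightarrow> \<bar>d\<bar> < 1 \<and> \<bar>c\<bar> < 1 - d \<and> \<rho> * stationary_variance c d < 1"
    and "\<rho> * stationary_variance c d = \<theta> / (2 * u)"
proof -
  show eq: "\<rho> * stationary_variance c d = \<theta> / (2 * u)"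
    by (simp add: \<rho>_def u_def stationary_variance_def)
  have stable: "\<bar>d\<bar> < 1 \<and> \<bar>c\<bar> < 1 - d" if "\<bar>c\<bar> < \<bar>1 - d\<bar>" "u > 0"
  proof -
    have d1: "1 - d \<noteq> 0" using that by auto
    have "c\<^sup>2 < (1 - d)\<^sup>2" using that(1) by (metis abs_ge_zero power2_abs power_strict_mono pos2)
    then have K: "((1 - d)\<^sup>2 - c\<^sup>2) / (l * \<alpha>\<^sup>2) > 0" using l \<alpha> by simp
    have "u = (1 + d) / (1 - d) * (((1 - d)\<^sup>2 - c\<^sup>2) / (l * \<alpha>\<^sup>2))"
      by (simp add: u_def)
    then have "(1 + d) / (1 - d) > 0" using that(2) K by (metis zero_less_mult_pos2)
    then have "\<bar>d\<bar> < 1" by (auto simp: zero_less_divide_iff)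
    then show ?thesis using that(1) by auto
  qed
  have upos: "u > 0" if "\<bar>d\<bar> < 1" "\<bar>c\<bar> < 1 - d"
  proof -
    have "c\<^sup>2 < (1 - d)\<^sup>2" using that(2) by (metis abs_ge_zero power2_abs power_strict_mono pos2)
    then show ?thesis using that l \<alpha> unfolding u_def by (intro divide_pos_pos mult_pos_pos) auto
  qed
  show "\<bar>c\<bar> < \<bar>1 - d\<bar> \<and> \<theta> < 2 * u \<longleftrightarrow> \<bar>d\<bar> < 1 \<and> \<bar>c\<bar> < 1 - d \<and> \<rho> * stationary_variance c d < 1"
  proof
    assume *: "\<bar>c\<bar> < \<bar>1 - d\<bar> \<and> \<theta> < 2 * u"
    then have "u > 0" using \<theta> by simp
    then show "\<bar>d\<bar> < 1 \<and> \<bar>c\<bar> < 1 - d \<and> \<rho> * stationary_variance c d < 1"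
      using * stable by (simp add: eq)
  next
    assume *: "\<bar>d\<bar> < 1 \<and> \<bar>c\<bar> < 1 - d \<and> \<rho> * stationary_variance c d < 1"
    then have "u > 0" using upos by blast
    then show "\<bar>c\<bar> < \<bar>1 - d\<bar> \<and> \<theta> < 2 * u" using * by (simp add: eq) linarith
  qed
qed

text \<open>
The energy increases with the horizon, so if it were at most \<open>(1 - \<epsilon>) / \<rho>\<close> forever it would be
summable; the recurrence would be stable, with stationary variance strictly below \<open>1 / \<rho>\<close>. This one
argument covers instability, variance above the threshold, and the boundary case of a variance that
reaches \<open>1 / \<rho>\<close> only in the limit.
\<close>

lemma impulse_energy_reaches_threshold:
  assumes \<rho>: "\<rho> > 0" and \<epsilon>: "\<epsilon> > 0"
    and bad: "\<not> (\<bar>d\<bar> < 1 \<and> \<bar>c\<bar> < 1 - d \<and> \<rho> * stationary_variance c d < 1)"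
  shows "eventually (\<lambda>k. 1 - \<rho> * (\<Sum>j<k. (impulse c d (Suc j))\<^sup>2) < \<epsilon>) sequentially"
proof -
  define S where "S k = (\<Sum>j<k. (impulse c d (Suc j))\<^sup>2)" for k
  have "\<exists>k0. 1 - \<rho> * S k0 < \<epsilon>"
  proof (rule ccontr)
    assume "\<nexists>k0. 1 - \<rho> * S k0 < \<epsilon>"
    then have bound: "S k \<le> (1 - \<epsilon>) / \<rho>" for k using \<rho> by (auto simp: not_less field_simps)
    then have summ: "summable (\<lambda>j. (impulse c d (Suc j))\<^sup>2)"
      unfolding S_def by (intro summableI_nonneg_bounded) auto
    note stable = impulse_summable_imp_stable[OF summ]
    have "S \<longlonglongrightarrow> stationary_variance c d"
      using stable_imp_impulse_sums(1)[OF stable] by (simp add: sums_def S_def[abs_def])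
    then have "stationary_variance c d \<le> (1 - \<epsilon>) / \<rho>"
      using bound by (intro LIMSEQ_le_const2) auto
    then have "\<rho> * stationary_variance c d < 1" using \<rho> \<epsilon> by (simp add: field_simps)
    then show False using bad stable by blast
  qed
  then obtain k0 where k0: "1 - \<rho> * S k0 < \<epsilon>" by blast
  show ?thesis
    unfolding eventually_sequentially
  proof (intro exI allI impI)
    fix k assume "k0 \<le> k"
    then have "S k0 \<le> S k" unfolding S_def by (intro sum_mono2) auto
    then show "1 - \<rho> * (\<Sum>j<k. (impulse c d (Suc j))\<^sup>2) < \<epsilon>"
      using k0 mult_left_mono[of "S k0" "S k" \<rho>] \<rho> unfolding S_def by linarith
  qed
qed

section \<open>Exponential moments of the square of a normal variable\<close>

text \<open>
Completing the square turns the integrand into a multiple of another normal density, with precision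
multiplied by \<open>1 - 2 * a * s\<^sup>2\<close>.
\<close>

lemma nn_integral_exp_square_normal_finite:
  assumes s: "s > 0" and a: "2 * a * s\<^sup>2 < 1"
  shows "(\<integral>\<^sup>+y. ennreal (exp (a * y\<^sup>2)) * ennreal (normal_density m s y) \<partial>lborel)
    = ennreal (exp (a * m\<^sup>2 / (1 - 2 * a * s\<^sup>2)) / sqrt (1 - 2 * a * s\<^sup>2))"
proof -
  define q where "q = 1 - 2 * a * s\<^sup>2"
  have q: "q > 0" using a by (simp add: q_def)
  define C where "C = exp (a * m\<^sup>2 / q) / sqrt q"
  have aq: "a = (1 - q) / (2 * s\<^sup>2)" using s by (simp add: q_def)
  have pt: "exp (a * y\<^sup>2) * normal_density m s y = C * normal_density (m / q) (s / sqrt q) y" for y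
  proof -
    have "a * y\<^sup>2 + - (y - m)\<^sup>2 / (2 * s\<^sup>2) = a * m\<^sup>2 / q + - (y - m / q)\<^sup>2 / (2 * (s / sqrt q)\<^sup>2)"
      using q s unfolding aq by (simp add: power_divide field_simps power2_eq_square)
    then have "exp (a * y\<^sup>2) * exp (- (y - m)\<^sup>2 / (2 * s\<^sup>2)) = exp (a * m\<^sup>2 / q) * exp (- (y - m / q)\<^sup>2 / (2 * (s / sqrt q)\<^sup>2))"
      by (simp only: exp_add[symmetric])
    moreover have "1 / sqrt (2 * pi * s\<^sup>2) = 1 / sqrt q * (1 / sqrt (2 * pi * (s / sqrt q)\<^sup>2))"
      using q s by (simp add: real_sqrt_mult real_sqrt_divide power_divide)
    ultimately show ?thesis by (simp add: normal_density_def C_def field_simps)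
  qed
  have "(\<integral>\<^sup>+y. ennreal (exp (a * y\<^sup>2)) * ennreal (normal_density m s y) \<partial>lborel)
    = (\<integral>\<^sup>+y. ennreal C * ennreal (normal_density (m / q) (s / sqrt q) y) \<partial>lborel)"
    using q by (intro nn_integral_cong) (simp add: ennreal_mult[symmetric] pt C_def)
  also have "\<dots> = ennreal C * (\<integral>\<^sup>+y. ennreal (normal_density (m / q) (s / sqrt q) y) \<partial>lborel)"
    by (rule nn_integral_cmult) simp
  also have "(\<integral>\<^sup>+y. ennreal (normal_density (m / q) (s / sqrt q) y) \<partial>lborel) = 1"
    using q s prob_space.emeasure_space_1[OF prob_space_normal_density[of "s / sqrt q" "m / q"]]
    by (simp add: emeasure_density)
  finally show ?thesis by (simp add: C_def q_def)
qed

lemma emeasure_lborel_halfline: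
  "emeasure lborel {0::real..} = \<infinity>" "emeasure lborel {..0::real} = \<infinity>"
proof -
  have large: "emeasure lborel S = \<infinity>" if "\<And>n. of_nat n \<le> emeasure lborel S" for S :: "real set"
    using that by (metis ennreal_Ex_less_of_nat infinity_ennreal_def linorder_not_less top.not_eq_extremum)
  have "of_nat n \<le> emeasure lborel {0::real..}" for n
    using emeasure_mono[of "{0..real n}" "{0..}" lborel] by (simp add: ennreal_of_nat_eq_real_of_nat)
  then show "emeasure lborel {0::real..} = \<infinity>" by (rule large)
  have "of_nat n \<le> emeasure lborel {..0::real}" for n
    using emeasure_mono[of "{- real n..0}" "{..0}" lborel] by (simp add: ennreal_of_nat_eq_real_of_nat)
  then show "emeasure lborel {..0::real} = \<infinity>" by (rule large)
qed

text \<open>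
When the quadratic terms in the exponent add up to something nonnegative, the integrand is bounded
below by a positive constant wherever the linear term is nonnegative, which includes a half-line.
\<close>

lemma nn_integral_exp_square_normal_infinite:
  assumes s: "s > 0" and a: "2 * a * s\<^sup>2 \<ge> 1"
  shows "(\<integral>\<^sup>+y. ennreal (exp (a * y\<^sup>2)) * ennreal (normal_density m s y) \<partial>lborel) = \<infinity>"
proof -
  define C where "C = exp (- m\<^sup>2 / (2 * s\<^sup>2)) / sqrt (2 * pi * s\<^sup>2)"
  have C: "C > 0" using s by (simp add: C_def)
  define H where "H = {y. y * m \<ge> 0}"
  have sub: "{0..} \<subseteq> H \<or> {..0} \<subseteq> H" by (auto simp: H_def mult_nonneg_nonneg mult_nonpos_nonpos) (smt (verit) mult_nonneg_nonneg mult_nonpos_nonpos)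
  have [measurable]: "H \<in> sets borel" unfolding H_def by measurable
  from sub have H: "emeasure lborel H = \<infinity>"
  proof
    assume "{0..} \<subseteq> H"
    then show ?thesis using emeasure_mono[of "{0..}" H lborel] by (simp add: emeasure_lborel_halfline top_unique)
  next
    assume "{..0} \<subseteq> H"
    then show ?thesis using emeasure_mono[of "{..0}" H lborel] by (simp add: emeasure_lborel_halfline top_unique)
  qed
  have "ennreal C * indicator H y \<le> ennreal (exp (a * y\<^sup>2)) * ennreal (normal_density m s y)" for y
  proof (cases "y \<in> H")
    case True
    have "- m\<^sup>2 / (2 * s\<^sup>2) \<le> a * y\<^sup>2 + - (y - m)\<^sup>2 / (2 * s\<^sup>2)"
    proof -
      have "y\<^sup>2 \<le> 2 * a * s\<^sup>2 * y\<^sup>2" using mult_right_mono[OF a, of "y\<^sup>2"] by simp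
      then show ?thesis using True s by (simp add: H_def field_simps power2_eq_square)
    qed
    then have "exp (- m\<^sup>2 / (2 * s\<^sup>2)) \<le> exp (a * y\<^sup>2) * exp (- (y - m)\<^sup>2 / (2 * s\<^sup>2))"
      by (simp only: exp_add[symmetric] exp_le_cancel_iff)
    then have "C \<le> exp (a * y\<^sup>2) * normal_density m s y"
      by (simp add: C_def normal_density_def divide_right_mono)
    then show ?thesis using True by (simp add: ennreal_mult[symmetric])
  qed simp
  then have "(\<integral>\<^sup>+y. ennreal C * indicator H y \<partial>lborel) \<le> (\<integral>\<^sup>+y. ennreal (exp (a * y\<^sup>2)) * ennreal (normal_density m s y) \<partial>lborel)"
    by (rule nn_integral_mono)
  moreover have "(\<integral>\<^sup>+y. ennreal C * indicator H y \<partial>lborel) = \<infinity>"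
    using C by (simp add: nn_integral_cmult_indicator H ennreal_mult_top)
  ultimately show ?thesis by (simp add: top_unique)
qed

text \<open>
For \<open>b > 0\<close>, the value of \<open>E[exp (b * X\<^sup>2)]\<close> for a normal variable \<open>X\<close> with mean \<open>m\<close> and variance \<open>q / (2 * b)\<close>.
The parameter \<open>q\<close> decides integrability, so it is kept in place of the variance.
\<close>

definition gaussian_square_mgf :: "real \<Rightarrow> real \<Rightarrow> real \<Rightarrow> ennreal" where
  "gaussian_square_mgf q b m = (if q < 1 then ennreal (exp (b * m\<^sup>2 / (1 - q)) / sqrt (1 - q)) else \<infinity>)"

lemma nn_integral_exp_square_normal:
  assumes "s > 0"
  shows "(\<integral>\<^sup>+y. ennreal (exp (b * y\<^sup>2)) * ennreal (normal_density m s y) \<partial>lborel)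
    = gaussian_square_mgf (2 * b * s\<^sup>2) b m"
proof (cases "2 * b * s\<^sup>2 < 1")
  case True
  then show ?thesis
    using nn_integral_exp_square_normal_finite[OF assms True] by (simp only: gaussian_square_mgf_def if_True)
next
  case False
  then have "1 \<le> 2 * b * s\<^sup>2" by simp
  then show ?thesis
    unfolding gaussian_square_mgf_def if_not_P[OF False]
    by (rule nn_integral_exp_square_normal_infinite[OF assms])
qed

text \<open>
For \<open>b \<ge> 0\<close> a nonzero mean only increases the value. With \<open>R = 1\<close> this bounds every factor of the
expectation from below, and with \<open>R\<close> large it makes a critical factor diverge.
\<close>

lemma gaussian_square_mgf_ge:
  assumes "b \<ge> 0" "R > 0" "1 - q \<le> 1 / R\<^sup>2"
  shows "ennreal R \<le> gaussian_square_mgf q b m"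
proof (cases "q < 1")
  case True
  have "sqrt (1 - q) \<le> 1 / R"
    using assms real_sqrt_le_mono[OF assms(3)] by (simp add: real_sqrt_divide)
  then have "R \<le> 1 / sqrt (1 - q)"
    using True assms by (simp add: field_simps)
  also have "\<dots> \<le> exp (b * m\<^sup>2 / (1 - q)) / sqrt (1 - q)"
    using True assms by (intro divide_right_mono) auto
  finally show ?thesis using True by (simp add: gaussian_square_mgf_def ennreal_leI)
qed (simp add: gaussian_square_mgf_def)

section \<open>Coordinates of isotropic Gaussian vectors\<close>

text \<open>
The image \<open>N\<close> of Lebesgue measure is translation invariant, because \<open>T\<close> is additive and surjective,
and agrees with Lebesgue measure on the unit ball \<open>U\<close>. Translation-invariant measures are proportional:
evaluating the double integral of \<open>indicator A x * indicator U (y - x)\<close> in both orders gives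
\<open>N A * lborel U = lborel A * N U\<close>.
\<close>

lemma distr_lborel_orthogonal:
  fixes T :: "'v::euclidean_space \<Rightarrow> 'v"
  assumes T: "orthogonal_transformation T"
  shows "distr lborel borel T = lborel"
proof -
  define N where "N = distr lborel borel T"
  have lin: "linear T" using T by (rule orthogonal_transformation_linear)
  then have [measurable]: "T \<in> borel_measurable borel"
    by (intro borel_measurable_continuous_onI linear_continuous_on) (simp add: linear_linear)
  have sets [measurable_cong]: "sets N = sets borel" by (simp add: N_def)
  have ball: "emeasure N (ball 0 r) = emeasure lborel (ball (0::'v) r)" for r
  proof -
    have "T -` ball 0 r = ball 0 r" by (auto simp: orthogonal_transformation_norm[OF T])
    then show ?thesis by (simp add: N_def emeasure_distr)
  qed
  interpret N: sigma_finite_measure N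
  proof
    have "emeasure N (ball 0 r) \<noteq> \<infinity>" for r
      using emeasure_lborel_ball_finite[of "0::'v" r] by (simp add: ball)
    moreover have "(\<Union>n. ball 0 (real n)) = (UNIV :: 'v set)"
      using reals_Archimedean2 by auto
    ultimately show "\<exists>A. countable A \<and> A \<subseteq> sets N \<and> \<Union> A = space N \<and> (\<forall>a\<in>A. emeasure N a \<noteq> \<infinity>)"
      by (intro exI[of _ "range (\<lambda>n. ball 0 (real n))"]) (auto simp: N_def)
  qed
  interpret pair_sigma_finite lborel N ..
  have translation_lborel: "(\<integral>\<^sup>+y. g (y + x) \<partial>lborel) = (\<integral>\<^sup>+y. g y \<partial>lborel)"
    if [measurable]: "g \<in> borel_measurable borel" for g :: "'v \<Rightarrow> ennreal" and x
  proof -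
    have "(\<integral>\<^sup>+y. g y \<partial>(distr lborel borel ((+) x))) = (\<integral>\<^sup>+y. g (x + y) \<partial>lborel)"
      by (rule nn_integral_distr) measurable
    then show ?thesis by (simp add: lborel_distr_plus add.commute)
  qed
  have translation_N: "(\<integral>\<^sup>+x. g (x + y) \<partial>N) = (\<integral>\<^sup>+x. g x \<partial>N)"
    if [measurable]: "g \<in> borel_measurable borel" for g :: "'v \<Rightarrow> ennreal" and y
  proof -
    obtain z where z: "y = T z" using orthogonal_transformation_surj[OF T] by (metis surjD)
    have "(\<integral>\<^sup>+x. g (x + y) \<partial>N) = (\<integral>\<^sup>+x. g (T (x + z)) \<partial>lborel)"
      by (simp add: N_def nn_integral_distr z linear_add[OF lin])
    also have "\<dots> = (\<integral>\<^sup>+x. g (T x) \<partial>lborel)"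
      by (rule translation_lborel) measurable
    also have "\<dots> = (\<integral>\<^sup>+x. g x \<partial>N)" by (simp add: N_def nn_integral_distr)
    finally show ?thesis .
  qed
  define U where "U = ball (0::'v) 1"
  have [measurable]: "U \<in> sets borel" by (simp add: U_def)
  have "emeasure N A = emeasure lborel A" if "A \<in> sets N" for A
  proof -
    have [measurable]: "A \<in> sets borel" using that sets by simp
    have "emeasure N A * emeasure lborel U = (\<integral>\<^sup>+x. \<integral>\<^sup>+y. indicator A x * indicator U y \<partial>lborel \<partial>N)"
      by (simp add: nn_integral_cmult nn_integral_multc sets)
    also have "\<dots> = (\<integral>\<^sup>+x. \<integral>\<^sup>+y. indicator A x * indicator U (y - x) \<partial>lborel \<partial>N)"
    proof (rule nn_integral_cong)
      fix x
      show "(\<integral>\<^sup>+y. indicator A x * indicator U y \<partial>lborel) = (\<integral>\<^sup>+y. (indicator A x * indicator U (y - x) :: ennreal) \<partial>lborel)"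
        using translation_lborel[of "\<lambda>y. indicator A x * indicator U y" "- x"] by simp
    qed
    also have "\<dots> = (\<integral>\<^sup>+y. \<integral>\<^sup>+x. indicator A x * indicator U (y - x) \<partial>N \<partial>lborel)"
      by (rule Fubini') measurable
    also have "\<dots> = (\<integral>\<^sup>+y. \<integral>\<^sup>+x. indicator A (x + y) * indicator U (- x) \<partial>N \<partial>lborel)"
    proof (rule nn_integral_cong)
      fix y
      show "(\<integral>\<^sup>+x. indicator A x * indicator U (y - x) \<partial>N) = (\<integral>\<^sup>+x. (indicator A (x + y) * indicator U (- x) :: ennreal) \<partial>N)"
        using translation_N[of "\<lambda>x. indicator A x * indicator U (y - x)" y] by simp
    qed
    also have "\<dots> = (\<integral>\<^sup>+x. \<integral>\<^sup>+y. indicator A (x + y) * indicator U (- x) \<partial>lborel \<partial>N)"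
      by (rule Fubini'[symmetric]) measurable
    also have "\<dots> = (\<integral>\<^sup>+x. emeasure lborel A * indicator U x \<partial>N)"
    proof (rule nn_integral_cong)
      fix x
      have "indicator U (- x) = (indicator U x :: ennreal)" by (simp add: U_def indicator_def)
      moreover have "(\<integral>\<^sup>+y. indicator A (x + y) \<partial>lborel) = emeasure lborel A"
        using translation_lborel[of "indicator A" x] by (simp add: add.commute)
      ultimately show "(\<integral>\<^sup>+y. indicator A (x + y) * indicator U (- x) \<partial>lborel) = emeasure lborel A * indicator U x"
        by (simp add: nn_integral_multc)
    qed
    also have "\<dots> = emeasure lborel A * emeasure lborel U"
      by (simp add: nn_integral_cmult_indicator sets) (simp add: U_def ball)
    finally have "emeasure N A * emeasure lborel U = emeasure lborel A * emeasure lborel U" .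
    moreover have "emeasure lborel U \<noteq> 0" "emeasure lborel U \<noteq> \<infinity>"
      using open_not_negligible[of "ball (0::'v) 1"] emeasure_lborel_ball_finite[of "0::'v" 1]
      by (auto simp: U_def negligible_iff_null_sets null_sets_def)
    ultimately show ?thesis by (simp add: ennreal_mult_cancel_left mult.commute[of _ "emeasure lborel U"])
  qed
  then show ?thesis using measure_eqI[of N lborel] sets by (simp add: N_def)
qed

lemma nn_integral_lborel_vec_prod:
  fixes f :: "'n::finite \<Rightarrow> real \<Rightarrow> ennreal"
  assumes f: "\<And>i. f i \<in> borel_measurable borel"
  shows "(\<integral>\<^sup>+y. (\<Prod>i\<in>UNIV. f i (y $ i)) \<partial>(lborel :: (real ^ 'n) measure)) = (\<Prod>i\<in>UNIV. \<integral>\<^sup>+t. f i t \<partial>lborel)"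
proof -
  have bij: "bij_betw (\<lambda>i. axis i (1::real)) (UNIV :: 'n set) Basis"
    by (auto simp: bij_betw_def inj_on_def axis_eq_axis Basis_vec_def)
  define g where "g b = f (SOME i. b = axis i (1::real))" for b :: "real ^ 'n"
  have g: "g (axis i 1) = f i" for i by (simp add: g_def axis_eq_axis)
  have "(\<integral>\<^sup>+y. (\<Prod>b\<in>Basis. g b (y \<bullet> b)) \<partial>(lborel :: (real ^ 'n) measure)) = (\<Prod>b\<in>Basis. \<integral>\<^sup>+t. g b t \<partial>lborel)"
    by (rule nn_integral_lborel_prod) (simp_all add: g_def f)
  then show ?thesis
    by (simp add: prod.reindex_bij_betw[OF bij, symmetric] g inner_axis)
qed

lemma gaussian_density_eq_prod:
  fixes v :: "real ^ 'n"
  shows "gaussian_density \<sigma> v = (\<Prod>i\<in>UNIV. normal_density 0 \<sigma> (v $ i))"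
proof -
  have "(norm v)\<^sup>2 = (\<Sum>i\<in>UNIV. (v $ i)\<^sup>2)"
    by (simp add: power2_norm_eq_inner inner_vec_def) (simp add: power2_eq_square)
  then have "exp (- (norm v)\<^sup>2 / (2 * \<sigma>\<^sup>2)) = (\<Prod>i\<in>UNIV. exp (- (v $ i)\<^sup>2 / (2 * \<sigma>\<^sup>2)))"
    by (simp only: exp_sum[OF finite, symmetric] sum_divide_distrib[symmetric] sum_negf)
  then show ?thesis
    by (simp add: gaussian_density_def normal_density_def prod_dividef mult.commute)
qed

text \<open>
An orthonormal family indexed by the coordinates is the image of the standard basis under an
orthogonal map, which allows changing variables to the coordinates of the family.
\<close>

lemma orthogonal_transformation_orthonormal_sum:
  fixes e :: "'n \<Rightarrow> real ^ 'n"
  assumes on: "\<And>i j. e i \<bullet> e j = (if i = j then 1 else 0)"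
  shows "orthogonal_transformation (\<lambda>y :: real ^ 'n. \<Sum>i\<in>UNIV. y $ i *\<^sub>R e i)"
    and "e i \<bullet> (\<Sum>j\<in>UNIV. y $ j *\<^sub>R e j) = y $ i"
proof -
  show co: "e i \<bullet> (\<Sum>j\<in>UNIV. y $ j *\<^sub>R e j) = y $ i" for i and y :: "real ^ 'n"
    by (simp add: inner_sum_right on if_distrib[of "\<lambda>a. _ * a"] sum.delta cong: if_cong)
  show "orthogonal_transformation (\<lambda>y :: real ^ 'n. \<Sum>i\<in>UNIV. y $ i *\<^sub>R e i)"
    unfolding orthogonal_transformation_def
  proof (intro conjI allI)
    show "linear (\<lambda>y :: real ^ 'n. \<Sum>i\<in>UNIV. y $ i *\<^sub>R e i)"
      by (intro linearI) (simp_all add: sum.distrib scaleR_add_left scaleR_sum_right)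
    fix y z :: "real ^ 'n"
    have "(\<Sum>i\<in>UNIV. y $ i *\<^sub>R e i) \<bullet> (\<Sum>i\<in>UNIV. z $ i *\<^sub>R e i) = (\<Sum>i\<in>UNIV. y $ i * (e i \<bullet> (\<Sum>j\<in>UNIV. z $ j *\<^sub>R e j)))"
      by (simp only: inner_sum_left inner_scaleR_left)
    also have "\<dots> = y \<bullet> z"
      by (simp only: co) (simp add: inner_vec_def)
    finally show "(\<Sum>i\<in>UNIV. y $ i *\<^sub>R e i) \<bullet> (\<Sum>i\<in>UNIV. z $ i *\<^sub>R e i) = y \<bullet> z" .
  qed
qed

lemma orthonormal_expansion:
  fixes e :: "'n \<Rightarrow> real ^ 'n"
  assumes on: "\<And>i j. e i \<bullet> e j = (if i = j then 1 else 0)"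
  shows "v = (\<Sum>i\<in>UNIV. (e i \<bullet> v) *\<^sub>R e i)"
proof -
  obtain y :: "real ^ 'n" where "v = (\<Sum>i\<in>UNIV. y $ i *\<^sub>R e i)"
    using surjD[OF orthogonal_transformation_surj[OF orthogonal_transformation_orthonormal_sum(1)[OF on]]]
    by blast
  then show ?thesis
    by (simp only: orthogonal_transformation_orthonormal_sum(2)[OF on])
qed

lemma borel_set_of_components:
  fixes e :: "'n::finite \<Rightarrow> 'v::euclidean_space"
  assumes B: "\<And>i. B i \<in> sets borel"
  shows "{v. \<forall>i. e i \<bullet> v \<in> B i} \<in> sets borel"
proof -
  have "(\<lambda>v. e i \<bullet> v) -` B i \<inter> space borel \<in> sets borel" for i
    by (rule measurable_sets[OF _ B]) measurable
  then have "(\<Inter>i. (\<lambda>v. e i \<bullet> v) -` B i \<inter> space borel) \<in> sets borel" by (intro sets.finite_INT) auto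
  moreover have "{v. \<forall>i. e i \<bullet> v \<in> B i} = (\<Inter>i. (\<lambda>v. e i \<bullet> v) -` B i \<inter> space borel)" by auto
  ultimately show ?thesis by simp
qed

text \<open>
The isotropic density is a product of one-dimensional ones and is invariant under rotations, so its
coordinates with respect to any orthonormal basis have the joint law of independent normal variables.
Both independence and the marginals are read off from this formula for rectangles.
\<close>

lemma (in prob_space) prob_gaussian_components:
  fixes W :: "'a \<Rightarrow> real ^ 'n" and e :: "'n \<Rightarrow> real ^ 'n"
  assumes W: "distributed M lborel W (\<lambda>v. ennreal (gaussian_density \<sigma> v))"
    and \<sigma>: "\<sigma> > 0"
    and on: "\<And>i j. e i \<bullet> e j = (if i = j then 1 else 0)"
    and B: "\<And>i. B i \<in> sets borel"
  shows "prob {\<omega> \<in> space M. \<forall>i. e i \<bullet> W \<omega> \<in> B i}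
    = (\<Prod>i\<in>UNIV. measure (density lborel (normal_density 0 \<sigma>)) (B i))"
proof -
  define T where "T y = (\<Sum>i\<in>UNIV. y $ i *\<^sub>R e i)" for y :: "real ^ 'n"
  have T: "orthogonal_transformation T"
    using orthogonal_transformation_orthonormal_sum(1)[OF on] by (simp add: T_def[abs_def])
  then have [measurable]: "T \<in> borel_measurable borel"
    by (intro borel_measurable_continuous_onI linear_continuous_on)
       (simp add: linear_linear orthogonal_transformation_linear)
  have co: "e i \<bullet> T y = y $ i" for i y
    unfolding T_def by (rule orthogonal_transformation_orthonormal_sum(2)[OF on])
  define S where "S = {v. \<forall>i. e i \<bullet> v \<in> B i}"
  have S [measurable]: "S \<in> sets borel" unfolding S_def by (rule borel_set_of_components) (rule B)
  have [measurable]: "gaussian_density \<sigma> \<in> borel_measurable borel"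
    unfolding gaussian_density_def by measurable
  have "{\<omega> \<in> space M. \<forall>i. e i \<bullet> W \<omega> \<in> B i} = W -` S \<inter> space M" by (auto simp: S_def)
  then have "emeasure M {\<omega> \<in> space M. \<forall>i. e i \<bullet> W \<omega> \<in> B i}
    = (\<integral>\<^sup>+v. ennreal (gaussian_density \<sigma> v) * indicator S v \<partial>lborel)"
    using distributed_emeasure[OF W, of S] S by simp
  also have "\<dots> = (\<integral>\<^sup>+v. ennreal (gaussian_density \<sigma> v) * indicator S v \<partial>(distr lborel borel T))"
    by (simp add: distr_lborel_orthogonal[OF T])
  also have "\<dots> = (\<integral>\<^sup>+y. ennreal (gaussian_density \<sigma> (T y)) * indicator S (T y) \<partial>lborel)"
    by (rule nn_integral_distr) measurable
  also have "\<dots> = (\<integral>\<^sup>+y. (\<Prod>i\<in>UNIV. ennreal (normal_density 0 \<sigma> (y $ i)) * indicator (B i) (y $ i)) \<partial>lborel)"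
  proof (rule nn_integral_cong)
    fix y :: "real ^ 'n"
    have "gaussian_density \<sigma> (T y) = gaussian_density \<sigma> y"
      by (simp add: gaussian_density_def orthogonal_transformation_norm[OF T])
    moreover have "indicator S (T y) = (\<Prod>i\<in>UNIV. indicator (B i) (y $ i) :: ennreal)"
      by (simp add: S_def co indicator_def prod.If_cases)
    ultimately show "ennreal (gaussian_density \<sigma> (T y)) * indicator S (T y)
        = (\<Prod>i\<in>UNIV. ennreal (normal_density 0 \<sigma> (y $ i)) * indicator (B i) (y $ i))"
      by (simp add: gaussian_density_eq_prod prod.distrib prod_ennreal)
  qed
  also have "\<dots> = (\<Prod>i\<in>UNIV. \<integral>\<^sup>+t. ennreal (normal_density 0 \<sigma> t) * indicator (B i) t \<partial>lborel)"
  proof (rule nn_integral_lborel_vec_prod)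
    fix i
    have [measurable]: "B i \<in> sets borel" by (rule B)
    show "(\<lambda>t. ennreal (normal_density 0 \<sigma> t) * indicator (B i) t) \<in> borel_measurable borel"
      by measurable
  qed
  also have "\<dots> = (\<Prod>i\<in>UNIV. emeasure (density lborel (normal_density 0 \<sigma>)) (B i))"
    using B by (simp add: emeasure_density)
  also have "\<dots> = ennreal (\<Prod>i\<in>UNIV. measure (density lborel (normal_density 0 \<sigma>)) (B i))"
  proof -
    interpret N: prob_space "density lborel (normal_density 0 \<sigma>)"
      using \<sigma> by (rule prob_space_normal_density)
    show ?thesis by (simp add: N.emeasure_eq_measure prod_ennreal)
  qed
  finally show ?thesis
    by (simp add: emeasure_eq_measure prod_nonneg)
qed

lemma (in prob_space) distributed_gaussian_component:
  fixes W :: "'a \<Rightarrow> real ^ 'n" and e :: "'n \<Rightarrow> real ^ 'n"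
  assumes W: "distributed M lborel W (\<lambda>v. ennreal (gaussian_density \<sigma> v))"
    and \<sigma>: "\<sigma> > 0"
    and on: "\<And>i j. e i \<bullet> e j = (if i = j then 1 else 0)"
  shows "distributed M lborel (\<lambda>\<omega>. e i \<bullet> W \<omega>) (normal_density 0 \<sigma>)"
proof -
  interpret N: prob_space "density lborel (normal_density 0 \<sigma>)"
    using \<sigma> by (rule prob_space_normal_density)
  have [measurable]: "random_variable borel W" using W by (simp add: distributed_def)
  show ?thesis
    unfolding distributed_def
  proof (intro conjI)
    show "distr M lborel (\<lambda>\<omega>. e i \<bullet> W \<omega>) = density lborel (normal_density 0 \<sigma>)"
    proof (rule measure_eqI)
      fix A assume "A \<in> sets (distr M lborel (\<lambda>\<omega>. e i \<bullet> W \<omega>))"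
      then have A: "A \<in> sets borel" by simp
      have "prob {\<omega> \<in> space M. \<forall>j. e j \<bullet> W \<omega> \<in> (if j = i then A else UNIV)}
        = (\<Prod>j\<in>UNIV. measure (density lborel (normal_density 0 \<sigma>)) (if j = i then A else UNIV))"
        using A by (intro prob_gaussian_components[OF W \<sigma> on]) auto
      also have "\<dots> = (\<Prod>j\<in>UNIV. if j = i then measure (density lborel (normal_density 0 \<sigma>)) A else 1)"
        using N.prob_space by (intro prod.cong) auto
      also have "\<dots> = measure (density lborel (normal_density 0 \<sigma>)) A"
        by simp
      finally have "prob {\<omega> \<in> space M. e i \<bullet> W \<omega> \<in> A} = measure (density lborel (normal_density 0 \<sigma>)) A"
        by (auto elim: back_subst[of "\<lambda>S. prob S = _"] split: if_splits)
      moreover have "(\<lambda>\<omega>. e i \<bullet> W \<omega>) -` A \<inter> space M = {\<omega> \<in> space M. e i \<bullet> W \<omega> \<in> A}" by auto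
      ultimately show "emeasure (distr M lborel (\<lambda>\<omega>. e i \<bullet> W \<omega>)) A = emeasure (density lborel (normal_density 0 \<sigma>)) A"
        using A by (simp add: emeasure_distr emeasure_eq_measure N.emeasure_eq_measure)
    qed simp
  qed simp_all
qed

text \<open>
Independence of each vector from the past only, together with adaptedness, makes the entire array of
coordinates independent: the probability of a rectangle splits off its last time slice, since the
earlier slices belong to the past, and within a slice it factorizes over the coordinates.
\<close>

lemma (in prob_space) indep_vars_adapted_gaussian_components:
  fixes w :: "nat \<Rightarrow> 'a \<Rightarrow> real ^ 'n" and e :: "'n \<Rightarrow> real ^ 'n"
  assumes w: "\<And>k. distributed M lborel (w k) (\<lambda>v. ennreal (gaussian_density \<sigma> v))"
    and \<sigma>: "\<sigma> > 0"
    and on: "\<And>i j. e i \<bullet> e j = (if i = j then 1 else 0)"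
    and F: "\<And>k. sigma_algebra (space M) (F k)"
    and adapted: "\<And>j k. j < k \<Longrightarrow> w j \<in> borel_measurable (sigma (space M) (F k))"
    and indep: "\<And>k. indep_set {w k -` A \<inter> space M | A. A \<in> sets borel} (F k)"
  shows "indep_vars (\<lambda>_. borel) (\<lambda>p \<omega>. e (snd p) \<bullet> w (fst p) \<omega>) ({..<k} \<times> UNIV)"
proof (cases "k = 0")
  case True
  then show ?thesis by (simp add: indep_vars_def indep_sets_def)
next
  case False
  define \<nu> where "\<nu> = measure (density lborel (normal_density 0 \<sigma>))"
  have rv: "random_variable borel (w k)" for k using w[of k] by (simp add: distributed_def)
  have rect: "prob {\<omega> \<in> space M. \<forall>j<k. \<forall>i. e i \<bullet> w j \<omega> \<in> B j i} = (\<Prod>j<k. \<Prod>i\<in>UNIV. \<nu> (B j i))"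
    if B: "\<And>j i. B j i \<in> sets borel" for B k
  proof (induction k)
    case 0
    show ?case by (simp add: prob_space)
  next
    case (Suc k)
    let ?N = "sigma (space M) (F k)"
    interpret F: sigma_algebra "space M" "F k" by (rule F)
    have N: "space ?N = space M" "sets ?N = F k"
      using F.space_closed by (simp_all add: F.sigma_sets_eq)
    define E where "E = {\<omega> \<in> space M. \<forall>j<k. \<forall>i. e i \<bullet> w j \<omega> \<in> B j i}"
    define S where "S = {v. \<forall>i. e i \<bullet> v \<in> B k i}"
    have "{\<omega> \<in> space ?N. \<forall>j\<in>{..<k}. \<forall>i\<in>UNIV. e i \<bullet> w j \<omega> \<in> B j i} \<in> sets ?N"
    proof (intro sets.sets_Collect_finite_All)
      fix j i assume "j \<in> {..<k}"
      then have [measurable]: "w j \<in> borel_measurable ?N" using adapted by simp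
      have [measurable]: "B j i \<in> sets borel" by (rule B)
      show "{\<omega> \<in> space ?N. e i \<bullet> w j \<omega> \<in> B j i} \<in> sets ?N" by measurable
    qed auto
    then have E: "E \<in> F k" by (simp add: N E_def Ball_def)
    have S [measurable]: "S \<in> sets borel" unfolding S_def by (rule borel_set_of_components) (rule B)
    have "{\<omega> \<in> space M. \<forall>j<Suc k. \<forall>i. e i \<bullet> w j \<omega> \<in> B j i} = (w k -` S \<inter> space M) \<inter> E"
      by (auto simp: E_def S_def less_Suc_eq)
    then have "prob {\<omega> \<in> space M. \<forall>j<Suc k. \<forall>i. e i \<bullet> w j \<omega> \<in> B j i} = prob (w k -` S \<inter> space M) * prob E"
      using indep_setD[OF indep[of k] _ E, of "w k -` S \<inter> space M"] S by (metis (mono_tags, lifting) mem_Collect_eq)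
    also have "w k -` S \<inter> space M = {\<omega> \<in> space M. \<forall>i. e i \<bullet> w k \<omega> \<in> B k i}" by (auto simp: S_def)
    also have "prob \<dots> = (\<Prod>i\<in>UNIV. \<nu> (B k i))"
      unfolding \<nu>_def by (rule prob_gaussian_components[OF w \<sigma> on B])
    finally show ?case using Suc by (simp add: E_def mult.commute)
  qed
  have single: "prob ((\<lambda>\<omega>. e i \<bullet> w j \<omega>) -` A \<inter> space M) = \<nu> A" if "A \<in> sets borel" for i j A
  proof -
    have "distributed M lborel (\<lambda>\<omega>. e i \<bullet> w j \<omega>) (normal_density 0 \<sigma>)"
      by (rule distributed_gaussian_component[OF w \<sigma> on])
    from distributed_emeasure[OF this, of A] that show ?thesis
      by (simp add: \<nu>_def measure_def emeasure_density)
  qed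
  have rvc: "random_variable borel (\<lambda>\<omega>. e i \<bullet> w j \<omega>)" for i j
    using rv[of j] by measurable
  show ?thesis
    unfolding indep_vars_def2
  proof (intro conjI ballI)
    show "random_variable borel (\<lambda>\<omega>. e (snd p) \<bullet> w (fst p) \<omega>)" for p by (rule rvc)
    show "indep_sets (\<lambda>p. {(\<lambda>\<omega>. e (snd p) \<bullet> w (fst p) \<omega>) -` A \<inter> space M | A. A \<in> sets borel}) ({..<k} \<times> UNIV)"
    proof (subst indep_sets_finite)
      show "{(\<lambda>\<omega>. e (snd p) \<bullet> w (fst p) \<omega>) -` A \<inter> space M | A. A \<in> sets borel} \<subseteq> events" for p
        using measurable_sets[OF rvc] by auto
      show "space M \<in> {(\<lambda>\<omega>. e (snd p) \<bullet> w (fst p) \<omega>) -` A \<inter> space M | A. A \<in> sets borel}" for p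
        by (auto intro!: exI[of _ UNIV])
      show "{..<k} \<times> (UNIV :: 'n set) \<noteq> {}" using False by auto
      show "\<forall>A\<in>Pi ({..<k} \<times> UNIV) (\<lambda>p. {(\<lambda>\<omega>. e (snd p) \<bullet> w (fst p) \<omega>) -` A \<inter> space M | A. A \<in> sets borel}).
        prob (\<Inter>p\<in>{..<k} \<times> UNIV. A p) = (\<Prod>p\<in>{..<k} \<times> UNIV. prob (A p))"
      proof
        fix A assume "A \<in> Pi ({..<k} \<times> UNIV) (\<lambda>p. {(\<lambda>\<omega>. e (snd p) \<bullet> w (fst p) \<omega>) -` A \<inter> space M | A. A \<in> sets borel})"
        then have "\<forall>p. \<exists>B. p \<in> {..<k} \<times> UNIV \<longrightarrow>
            A p = (\<lambda>\<omega>. e (snd p) \<bullet> w (fst p) \<omega>) -` B \<inter> space M \<and> B \<in> sets borel"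
          by (fastforce simp: Pi_iff)
        then obtain B where B: "\<And>p. p \<in> {..<k} \<times> UNIV \<Longrightarrow>
            A p = (\<lambda>\<omega>. e (snd p) \<bullet> w (fst p) \<omega>) -` B p \<inter> space M \<and> B p \<in> sets borel"
          by metis
        \<comment> \<open>The values of \<open>B\<close> outside the index set are arbitrary and need not be Borel sets.\<close>
        define B' where "B' j i = (if j < k then B (j, i) else UNIV)" for j i
        have B': "B' j i \<in> sets borel" for j i using B[of "(j, i)"] by (simp add: B'_def)
        have "(\<Inter>p\<in>{..<k} \<times> UNIV. A p) = {\<omega> \<in> space M. \<forall>j<k. \<forall>i. e i \<bullet> w j \<omega> \<in> B' j i}"
          using B False by (auto simp: B'_def)
        then have "prob (\<Inter>p\<in>{..<k} \<times> UNIV. A p) = (\<Prod>j<k. \<Prod>i\<in>UNIV. \<nu> (B' j i))"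
          using rect[of B', OF B'] by simp
        also have "\<dots> = (\<Prod>p\<in>{..<k} \<times> UNIV. prob (A p))"
          unfolding prod.cartesian_product'
        proof (rule prod.cong[OF refl], rule prod.cong[OF refl])
          fix j i assume "j \<in> {..<k}"
          then show "\<nu> (B' j i) = prob (A (j, i))" using B[of "(j, i)"] by (simp add: B'_def single)
        qed
        finally show "prob (\<Inter>p\<in>{..<k} \<times> UNIV. A p) = (\<Prod>p\<in>{..<k} \<times> UNIV. prob (A p))" .
      qed
    qed simp
  qed
qed

text \<open>
Terms with coefficient 0 are degenerate and have no density, so they are dropped before adding normal
variables; one nonzero coefficient keeps the sum nondegenerate.
\<close>

lemma (in prob_space) distributed_affine_normal_sum:
  assumes J: "finite J" and indep: "indep_vars (\<lambda>_. borel) \<eta> J"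
    and normal: "\<And>j. j \<in> J \<Longrightarrow> distributed M lborel (\<eta> j) (normal_density 0 \<sigma>)"
    and \<sigma>: "\<sigma> > 0" and nonzero: "\<exists>j\<in>J. a j \<noteq> 0"
  shows "distributed M lborel (\<lambda>\<omega>. m + (\<Sum>j\<in>J. a j * \<eta> j \<omega>))
    (normal_density m (\<sigma> * sqrt (\<Sum>j\<in>J. (a j)\<^sup>2)))"
proof -
  define J' where "J' = {j \<in> J. a j \<noteq> 0}"
  have J': "finite J'" "J' \<noteq> {}" using J nonzero by (auto simp: J'_def)
  have "indep_vars (\<lambda>_. borel) (\<lambda>j \<omega>. a j * \<eta> j \<omega>) J"
    by (rule indep_vars_compose2[OF indep]) simp
  then have "indep_vars (\<lambda>_. borel) (\<lambda>j \<omega>. a j * \<eta> j \<omega>) J'"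
    by (rule indep_vars_subset) (auto simp: J'_def)
  moreover have "distributed M lborel (\<lambda>\<omega>. a j * \<eta> j \<omega>) (normal_density 0 (\<bar>a j\<bar> * \<sigma>))" if "j \<in> J'" for j
    using normal_density_affine[OF normal \<sigma>, of j "a j" 0] that by (simp add: J'_def)
  ultimately have "distributed M lborel (\<lambda>\<omega>. \<Sum>j\<in>J'. a j * \<eta> j \<omega>)
      (normal_density (\<Sum>j\<in>J'. 0) (sqrt (\<Sum>j\<in>J'. (\<bar>a j\<bar> * \<sigma>)\<^sup>2)))"
    using \<sigma> J' by (intro sum_indep_normal) (auto simp: J'_def)
  moreover have "(\<Sum>j\<in>J'. (\<bar>a j\<bar> * \<sigma>)\<^sup>2) = \<sigma>\<^sup>2 * (\<Sum>j\<in>J'. (a j)\<^sup>2)"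
    by (simp add: power_mult_distrib sum_distrib_left mult.commute)
  moreover have "(\<Sum>j\<in>J'. (a j)\<^sup>2) = (\<Sum>j\<in>J. (a j)\<^sup>2)"
    by (rule sum.mono_neutral_left) (auto simp: J'_def J)
  moreover have "(\<Sum>j\<in>J'. a j * \<eta> j \<omega>) = (\<Sum>j\<in>J. a j * \<eta> j \<omega>)" for \<omega>
    by (rule sum.mono_neutral_left) (auto simp: J'_def J)
  ultimately have "distributed M lborel (\<lambda>\<omega>. \<Sum>j\<in>J. a j * \<eta> j \<omega>)
      (normal_density 0 (\<sigma> * sqrt (\<Sum>j\<in>J. (a j)\<^sup>2)))"
    using \<sigma> by (simp add: real_sqrt_mult)
  moreover obtain j where "j \<in> J" "a j \<noteq> 0" using nonzero by blast
  then have "(\<Sum>j\<in>J. (a j)\<^sup>2) > 0" using J by (intro sum_pos2[of _ j]) auto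
  then have "\<sigma> * sqrt (\<Sum>j\<in>J. (a j)\<^sup>2) > 0" using \<sigma> by simp
  ultimately show ?thesis
    using normal_density_affine[of "\<lambda>\<omega>. \<Sum>j\<in>J. a j * \<eta> j \<omega>" 0 "\<sigma> * sqrt (\<Sum>j\<in>J. (a j)\<^sup>2)" 1 m] by simp
qed

text \<open>
The \<open>i\<close>-th summand of the exponent depends only on the \<open>i\<close>-th column of the array \<open>\<eta>\<close>, so the summands
are independent, and the expectation of the exponential factorizes.
\<close>

lemma (in prob_space) nn_integral_exp_sum_squares_gaussian:
  fixes \<eta> :: "nat \<times> 'n::finite \<Rightarrow> 'a \<Rightarrow> real"
  assumes indep: "indep_vars (\<lambda>_. borel) \<eta> ({..<k} \<times> UNIV)"
    and normal: "\<And>p. distributed M lborel (\<eta> p) (normal_density 0 \<sigma>)"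
    and \<sigma>: "\<sigma> > 0" and nonzero: "\<And>i. \<exists>j<k. a j i \<noteq> 0"
  shows "(\<integral>\<^sup>+\<omega>. ennreal (exp (\<Sum>i\<in>UNIV. b i * (m i + (\<Sum>j<k. a j i * \<eta> (j, i) \<omega>))\<^sup>2)) \<partial>M)
    = (\<Prod>i\<in>UNIV. \<integral>\<^sup>+y. ennreal (exp (b i * y\<^sup>2)) *
        ennreal (normal_density (m i) (\<sigma> * sqrt (\<Sum>j<k. (a j i)\<^sup>2)) y) \<partial>lborel)"
proof -
  define Y where "Y i \<omega> = m i + (\<Sum>j<k. a j i * \<eta> (j, i) \<omega>)" for i \<omega>
  have "indep_vars (\<lambda>i. PiM ({..<k} \<times> {i}) (\<lambda>_. borel))
      (\<lambda>i \<omega>. restrict (\<lambda>p. \<eta> p \<omega>) ({..<k} \<times> {i})) (UNIV :: 'n set)"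
    by (rule indep_vars_restrict[OF indep]) (auto simp: disjoint_family_on_def)
  then have "indep_vars (\<lambda>_. borel)
      (\<lambda>i \<omega>. ennreal (exp (b i * (m i + (\<Sum>j<k. a j i * restrict (\<lambda>p. \<eta> p \<omega>) ({..<k} \<times> {i}) (j, i)))\<^sup>2))) (UNIV :: 'n set)"
    by (rule indep_vars_compose2) measurable
  then have ind: "indep_vars (\<lambda>_. borel) (\<lambda>i \<omega>. ennreal (exp (b i * (Y i \<omega>)\<^sup>2))) UNIV"
    by (simp add: Y_def cong: sum.cong_simp)
  have dist: "distributed M lborel (Y i) (normal_density (m i) (\<sigma> * sqrt (\<Sum>j<k. (a j i)\<^sup>2)))" for i
  proof -
    have "indep_vars (\<lambda>_. borel) \<eta> ({..<k} \<times> {i})"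
      using indep by (rule indep_vars_subset) auto
    moreover have "\<exists>p\<in>{..<k} \<times> {i}. a (fst p) (snd p) \<noteq> 0" using nonzero[of i] by force
    ultimately have "distributed M lborel (\<lambda>\<omega>. m i + (\<Sum>p\<in>{..<k} \<times> {i}. a (fst p) (snd p) * \<eta> p \<omega>))
        (normal_density (m i) (\<sigma> * sqrt (\<Sum>p\<in>{..<k} \<times> {i}. (a (fst p) (snd p))\<^sup>2)))"
      by (intro distributed_affine_normal_sum normal \<sigma>) auto
    moreover have "(\<Sum>p\<in>{..<k} \<times> {i}. g p) = (\<Sum>j<k. g (j, i))" for g :: "nat \<times> 'n \<Rightarrow> real"
      by (simp add: sum.cartesian_product')
    ultimately show ?thesis by (simp add: Y_def[abs_def])
  qed
  have "(\<integral>\<^sup>+\<omega>. ennreal (exp (\<Sum>i\<in>UNIV. b i * (Y i \<omega>)\<^sup>2)) \<partial>M)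
      = (\<integral>\<^sup>+\<omega>. (\<Prod>i\<in>UNIV. ennreal (exp (b i * (Y i \<omega>)\<^sup>2))) \<partial>M)"
    by (simp add: exp_sum prod_ennreal)
  also have "\<dots> = (\<Prod>i\<in>UNIV. \<integral>\<^sup>+\<omega>. ennreal (exp (b i * (Y i \<omega>)\<^sup>2)) \<partial>M)"
    by (rule indep_vars_nn_integral[OF _ ind]) auto
  also have "\<dots> = (\<Prod>i\<in>UNIV. \<integral>\<^sup>+y. ennreal (exp (b i * y\<^sup>2)) *
      ennreal (normal_density (m i) (\<sigma> * sqrt (\<Sum>j<k. (a j i)\<^sup>2)) y) \<partial>lborel)"
    by (intro prod.cong refl, subst mult.commute, intro distributed_nn_integral[OF dist, symmetric]) simp
  finally show ?thesis by (simp only: Y_def)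
qed

section \<open>Quadratic objectives\<close>

lemma has_derivative_quad:
  assumes sym: "transpose Q = Q"
  shows "(quad Q p r has_derivative (\<lambda>h. h \<bullet> (Q *v y + p))) (at y)"
proof -
  have Q: "((\<lambda>x. Q *v x) has_derivative (\<lambda>h. Q *v h)) (at y)"
    by (rule bounded_linear.has_derivative[OF matrix_vector_mul_bounded_linear has_derivative_ident])
  have "((\<lambda>x. 1 / 2 * (x \<bullet> (Q *v x)) + p \<bullet> x + r) has_derivative
      (\<lambda>h. 1 / 2 * (y \<bullet> (Q *v h) + h \<bullet> (Q *v y)) + p \<bullet> h + 0)) (at y)"
    by (intro derivative_intros Q)
  moreover have "1 / 2 * (y \<bullet> (Q *v h) + h \<bullet> (Q *v y)) + p \<bullet> h + 0 = h \<bullet> (Q *v y + p)" for h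
    using symmetric_matrix_inner[OF sym, of y h] by (simp add: inner_add_right inner_commute)
  ultimately show ?thesis by (simp add: quad_def[abs_def])
qed

lemma gradient_quad:
  assumes sym: "transpose Q = Q"
  shows "gradient (quad Q p r) y = Q *v y + p"
  unfolding gradient_def
proof (rule the_equality)
  show "GDERIV (quad Q p r) y :> Q *v y + p"
    unfolding gderiv_def by (rule has_derivative_quad[OF sym])
  fix D assume "GDERIV (quad Q p r) y :> D"
  then have "(\<lambda>h. h \<bullet> D) = (\<lambda>h. h \<bullet> (Q *v y + p))"
    unfolding gderiv_def using has_derivative_quad[OF sym] has_derivative_unique by blast
  then show "D = Q *v y + p" by (metis vector_eq_ldot)
qed

lemma quad_minimizer_stationary:
  assumes sym: "transpose Q = Q" and min: "is_arg_min (quad Q p r) (\<lambda>_. True) xs"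
  shows "Q *v xs + p = 0"
proof -
  have "(\<lambda>h. h \<bullet> (Q *v xs + p)) = (\<lambda>h. 0)"
    using min by (intro has_derivative_local_min[OF has_derivative_quad[OF sym, where r = r]])
      (auto simp: is_arg_min_def not_less)
  then show ?thesis by (metis inner_eq_zero_iff)
qed

text \<open>
Expanding around the stationary point removes the linear term, so the excess risk is a weighted sum
of squares of eigencoordinates, one for each decoupled scalar recursion.
\<close>

lemma quad_excess_eigenbasis:
  fixes e :: "'n \<Rightarrow> real ^ 'n"
  assumes sym: "transpose Q = Q" and stat: "Q *v xs + p = 0"
    and on: "\<And>i j. e i \<bullet> e j = (if i = j then 1 else 0)"
    and eig: "\<And>i. Q *v e i = l i *\<^sub>R e i"
  shows "quad Q p r x - quad Q p r xs = (\<Sum>i\<in>UNIV. l i / 2 * (e i \<bullet> (x - xs))\<^sup>2)"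
proof -
  define v where "v = x - xs"
  have x: "x = xs + v" by (simp add: v_def)
  have p: "p = - (Q *v xs)" using stat by (simp add: add_eq_0_iff)
  have "quad Q p r x - quad Q p r xs = 1 / 2 * (v \<bullet> (Q *v v))"
    using symmetric_matrix_inner[OF sym, of xs v]
    by (simp add: quad_def x p matrix_vector_right_distrib inner_add_left inner_add_right inner_commute
        field_simps)
  also have "v \<bullet> (Q *v v) = (\<Sum>i\<in>UNIV. (e i \<bullet> v) * (e i \<bullet> (Q *v v)))"
    by (subst (1) orthonormal_expansion[OF on]) (simp add: inner_sum_left)
  also have "\<dots> = (\<Sum>i\<in>UNIV. l i * (e i \<bullet> v)\<^sup>2)"
    by (intro sum.cong refl)
       (simp add: symmetric_matrix_inner[OF sym] eig power2_eq_square)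
  finally show ?thesis by (simp add: v_def sum_distrib_left)
qed

section \<open>Entropic risk of the momentum method\<close>

text \<open>
Along the eigenvector \<open>e i\<close> the iterates satisfy a scalar recurrence with coefficients \<open>c i\<close> and
\<open>d i\<close>. Hence the \<open>i\<close>-th coordinate of the error is normal; its mean comes from the initial values, and its
variance is \<open>\<sigma>\<^sup>2 * \<alpha>\<^sup>2\<close> times the energy of the impulse response up to time \<open>k\<close>. Assuming \<open>k > 0\<close> excludes the
deterministic initial iterate, whose coordinates have no density. The past generated by the iterates contains the earlier noise, because
the recursion can be solved for the noise as \<open>\<alpha>\<close> is nonzero.
\<close>

lemma gmm_expectation_product:
  fixes e :: "'n \<Rightarrow> real ^ 'n" and k :: nat
  assumes M: "prob_space M"
    and sym: "transpose Q = Q"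
    and on: "\<And>i j. e i \<bullet> e j = (if i = j then 1 else 0)"
    and eig: "\<And>i. Q *v e i = l i *\<^sub>R e i"
    and min: "is_arg_min (quad Q p r) (\<lambda>_. True) xs"
    and \<alpha>: "\<alpha> > 0" and \<sigma>: "\<sigma> > 0" and k: "k > 0"
    and gmm: "noisy_gmm M (quad Q p r) \<alpha> \<beta> \<gamma> x0 xm1 w x"
    and noise: "gaussian_noise M \<sigma> w x"
  defines "c \<equiv> \<lambda>i. 1 + \<beta> - \<alpha> * (1 + \<gamma>) * l i" and "d \<equiv> \<lambda>i. - (\<beta> - \<alpha> * \<gamma> * l i)"
  shows "(\<integral>\<^sup>+\<omega>. ennreal (exp (\<theta> / (2 * \<sigma>\<^sup>2) * (quad Q p r (x (int k) \<omega>) - quad Q p r xs))) \<partial>M)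
    = (\<Prod>i\<in>UNIV. gaussian_square_mgf (\<theta> * l i * \<alpha>\<^sup>2 / 2 * (\<Sum>j<k. (impulse (c i) (d i) (Suc j))\<^sup>2))
        (\<theta> * l i / (4 * \<sigma>\<^sup>2))
        (impulse (c i) (d i) (Suc k) * (e i \<bullet> (x0 - xs)) + d i * impulse (c i) (d i) k * (e i \<bullet> (xm1 - xs))))"
proof -
  interpret prob_space M by (rule M)
  define W where "W k = w (Suc k)" for k
  have stat: "Q *v xs + p = 0" by (rule quad_minimizer_stationary[OF sym min])
  have init: "x 0 \<omega> = x0" "x (- 1) \<omega> = xm1" if "\<omega> \<in> space M" for \<omega>
    using gmm that by (auto simp: noisy_gmm_def)
  have step: "x (int k + 1) \<omega> = (1 + \<beta>) *\<^sub>R x (int k) \<omega> - \<beta> *\<^sub>R x (int k - 1) \<omega>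
      - \<alpha> *\<^sub>R (Q *v ((1 + \<gamma>) *\<^sub>R x (int k) \<omega> - \<gamma> *\<^sub>R x (int k - 1) \<omega>) + p + W k \<omega>)" if "\<omega> \<in> space M" for \<omega> k
    using gmm that by (simp add: noisy_gmm_def gradient_quad[OF sym] W_def)
  have W: "distributed M lborel (W k) (\<lambda>v. ennreal (gaussian_density \<sigma> v))" for k
    using noise by (simp add: gaussian_noise_def W_def)
  then have Wm: "random_variable borel (W k)" for k by (simp add: distributed_def)

  define F where "F = iterate_sigma_algebra M x"
  define gen where "gen k = (\<Union>j\<in>{..k}. {x (int j) -` A \<inter> space M | A. A \<in> sets borel})" for k
  have gen: "gen k \<subseteq> Pow (space M)" for k by (auto simp: gen_def)
  have F_eq: "F k = sigma_sets (space M) (gen k)" for k by (simp add: F_def iterate_sigma_algebra_def gen_def)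
  have F: "sigma_algebra (space M) (F k)" for k
    unfolding F_eq by (rule sigma_algebra_sigma_sets[OF gen])
  have indep: "indep_set {W k -` A \<inter> space M | A. A \<in> sets borel} (F k)" for k
    using noise by (simp add: gaussian_noise_def W_def F_def)
  have adapted: "W j \<in> borel_measurable (sigma (space M) (F k))" if "j < k" for j k
  proof -
    let ?N = "sigma (space M) (F k)"
    have N: "space ?N = space M" "sets ?N = F k"
      by (simp_all add: sigma_algebra.sets_measure_of_eq[OF F] sigma_algebra.space_measure_of_eq[OF F])
    have nat: "x (int i) \<in> borel_measurable ?N" if "i \<le> k" for i
    proof (rule measurableI)
      fix A :: "(real ^ 'n) set" assume "A \<in> sets borel"
      then have "x (int i) -` A \<inter> space M \<in> gen k" using that by (auto simp: gen_def)
      then show "x (int i) -` A \<inter> space ?N \<in> sets ?N" unfolding N by (simp add: F_eq)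
    qed simp
    have "(\<lambda>\<omega>. xm1) \<in> borel_measurable ?N" by simp
    then have "x (- 1) \<in> borel_measurable ?N"
      by (subst measurable_cong[where g = "\<lambda>_. xm1"]) (simp_all add: N init)
    \<comment> \<open>For \<open>j = 0\<close> this is the iterate at time \<open>- 1\<close>, which does not generate the past but is constant.\<close>
    then have prev: "x (int j - 1) \<in> borel_measurable ?N"
      using nat[of "j - 1"] \<open>j < k\<close> by (cases j) auto
    have cur: "x (int j) \<in> borel_measurable ?N" and succ: "x (int j + 1) \<in> borel_measurable ?N"
      using nat[of j] nat[of "Suc j"] \<open>j < k\<close> by (auto simp: add.commute)
    have mv: "(\<lambda>\<omega>. Q *v g \<omega>) \<in> borel_measurable ?N" if "g \<in> borel_measurable ?N" for g :: "'a \<Rightarrow> real ^ 'n"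
      using that by (rule borel_measurable_continuous_on[rotated])
        (intro linear_continuous_on matrix_vector_mul_bounded_linear)
    \<comment> \<open>The recursion solved for the noise.\<close>
    let ?g = "\<lambda>\<omega>. (1 / \<alpha>) *\<^sub>R ((1 + \<beta>) *\<^sub>R x (int j) \<omega> - \<beta> *\<^sub>R x (int j - 1) \<omega> - x (int j + 1) \<omega>)
        - Q *v ((1 + \<gamma>) *\<^sub>R x (int j) \<omega> - \<gamma> *\<^sub>R x (int j - 1) \<omega>) - p"
    have "?g \<in> borel_measurable ?N"
      by (intro borel_measurable_diff borel_measurable_scaleR borel_measurable_const mv cur prev succ)
    moreover have "W j \<omega> = ?g \<omega>" if "\<omega> \<in> space M" for \<omega>
      using \<alpha> by (simp only: step[OF that]) (simp add: algebra_simps)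
    ultimately show ?thesis by (subst measurable_cong[where g = ?g]) (simp_all add: N)
  qed

  define \<eta> where "\<eta> q \<omega> = e (snd q) \<bullet> W (fst q) \<omega>" for q :: "nat \<times> 'n" and \<omega>
  have \<eta>_indep: "indep_vars (\<lambda>_. borel) \<eta> ({..<k} \<times> UNIV)"
    using indep_vars_adapted_gaussian_components[OF W \<sigma> on F adapted indep, where k = k] by (simp add: \<eta>_def[abs_def])
  have \<eta>_normal: "distributed M lborel (\<eta> q) (normal_density 0 \<sigma>)" for q
    using distributed_gaussian_component[OF W \<sigma> on] by (simp add: \<eta>_def[abs_def])

  define m where "m i = impulse (c i) (d i) (Suc k) * (e i \<bullet> (x0 - xs)) + d i * impulse (c i) (d i) k * (e i \<bullet> (xm1 - xs))" for i
  define a where "a j i = - \<alpha> * impulse (c i) (d i) (k - j)" for j i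
  have mode: "e i \<bullet> (x (int k) \<omega> - xs) = m i + (\<Sum>j<k. a j i * \<eta> (j, i) \<omega>)" if \<omega>: "\<omega> \<in> space M" for i \<omega>
  proof -
    \<comment> \<open>Indices are shifted by one so that \<open>z 0\<close> belongs to the iterate at time \<open>- 1\<close>.\<close>
    define z where "z n = e i \<bullet> (x (int n - 1) \<omega> - xs)" for n
    have eQ: "e i \<bullet> (Q *v v) = l i * (e i \<bullet> v)" for v
      by (simp add: symmetric_matrix_inner[OF sym] eig)
    have ep: "e i \<bullet> p = - l i * (e i \<bullet> xs)"
      using arg_cong[OF stat, of "\<lambda>v. e i \<bullet> v"] by (simp add: inner_add_right eQ)
    have "z (Suc (Suc n)) = c i * z (Suc n) + d i * z n + - \<alpha> * \<eta> (n, i) \<omega>" for n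
    proof -
      have "x (int (Suc (Suc n)) - 1) \<omega> = x (int n + 1) \<omega>" "x (int (Suc n) - 1) \<omega> = x (int n) \<omega>"
        by (simp_all add: add.commute)
      then show ?thesis
        unfolding z_def by (simp only: step[OF \<omega>])
          (simp add: \<eta>_def c_def d_def inner_diff_right inner_add_right eQ ep algebra_simps)
    qed
    then have "z (Suc k) = impulse (c i) (d i) (Suc k) * z 1 + d i * impulse (c i) (d i) k * z 0
        + (\<Sum>j<k. impulse (c i) (d i) (k - j) * (- \<alpha> * \<eta> (j, i) \<omega>))"
      by (rule recurrence_solution)
    then show ?thesis
      by (simp add: z_def m_def a_def init[OF \<omega>] mult.assoc mult.left_commute)
  qed
  have energy: "(\<Sum>j<k. (a j i)\<^sup>2) = \<alpha>\<^sup>2 * (\<Sum>j<k. (impulse (c i) (d i) (Suc j))\<^sup>2)" for i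
  proof -
    have "(\<Sum>j<k. (impulse (c i) (d i) (k - j))\<^sup>2) = (\<Sum>j<k. (impulse (c i) (d i) (Suc (k - Suc j)))\<^sup>2)"
      by (intro sum.cong refl) (simp add: Suc_diff_Suc)
    also have "\<dots> = (\<Sum>j<k. (impulse (c i) (d i) (Suc j))\<^sup>2)"
      by (rule sum.nat_diff_reindex)
    finally show ?thesis by (simp add: a_def power_mult_distrib sum_distrib_left[symmetric])
  qed
  \<comment> \<open>The most recent noise enters with weight \<open>- \<alpha>\<close>, so no coordinate is degenerate.\<close>
  have last: "a (k - 1) i = - \<alpha>" for i using k by (simp add: a_def)
  then have nonzero: "\<exists>j<k. a j i \<noteq> 0" for i using \<alpha> k by (intro exI[of _ "k - 1"]) auto
  have "(\<integral>\<^sup>+\<omega>. ennreal (exp (\<theta> / (2 * \<sigma>\<^sup>2) * (quad Q p r (x (int k) \<omega>) - quad Q p r xs))) \<partial>M)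
    = (\<integral>\<^sup>+\<omega>. ennreal (exp (\<Sum>i\<in>UNIV. \<theta> * l i / (4 * \<sigma>\<^sup>2) * (m i + (\<Sum>j<k. a j i * \<eta> (j, i) \<omega>))\<^sup>2)) \<partial>M)"
    by (intro nn_integral_cong)
       (simp add: quad_excess_eigenbasis[OF sym stat on eig] mode sum_distrib_left mult.assoc)
  also have "\<dots> = (\<Prod>i\<in>UNIV. \<integral>\<^sup>+y. ennreal (exp (\<theta> * l i / (4 * \<sigma>\<^sup>2) * y\<^sup>2)) *
        ennreal (normal_density (m i) (\<sigma> * sqrt (\<Sum>j<k. (a j i)\<^sup>2)) y) \<partial>lborel)"
    by (rule nn_integral_exp_sum_squares_gaussian[OF \<eta>_indep \<eta>_normal \<sigma> nonzero])
  also have "\<dots> = (\<Prod>i\<in>UNIV. gaussian_square_mgf (\<theta> * l i * \<alpha>\<^sup>2 / 2 * (\<Sum>j<k. (impulse (c i) (d i) (Suc j))\<^sup>2))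
        (\<theta> * l i / (4 * \<sigma>\<^sup>2)) (m i))"
  proof (rule prod.cong[OF refl])
    fix i
    define s where "s = \<sigma> * sqrt (\<Sum>j<k. (a j i)\<^sup>2)"
    have "(\<Sum>j<k. (a j i)\<^sup>2) > 0" using last[of i] \<alpha> k by (intro sum_pos2[of _ "k - 1"]) auto
    then have s: "s > 0" "s\<^sup>2 = \<sigma>\<^sup>2 * (\<Sum>j<k. (a j i)\<^sup>2)" using \<sigma> by (simp_all add: s_def power_mult_distrib)
    have q: "2 * (\<theta> * l i / (4 * \<sigma>\<^sup>2)) * s\<^sup>2 = \<theta> * l i * \<alpha>\<^sup>2 / 2 * (\<Sum>j<k. (impulse (c i) (d i) (Suc j))\<^sup>2)"
      using \<sigma> by (simp add: s(2) energy field_simps)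
    show "(\<integral>\<^sup>+y. ennreal (exp (\<theta> * l i / (4 * \<sigma>\<^sup>2) * y\<^sup>2)) *
        ennreal (normal_density (m i) (\<sigma> * sqrt (\<Sum>j<k. (a j i)\<^sup>2)) y) \<partial>lborel)
      = gaussian_square_mgf (\<theta> * l i * \<alpha>\<^sup>2 / 2 * (\<Sum>j<k. (impulse (c i) (d i) (Suc j))\<^sup>2)) (\<theta> * l i / (4 * \<sigma>\<^sup>2)) (m i)"
      unfolding s_def[symmetric] q[symmetric] by (rule nn_integral_exp_square_normal[OF s(1)])
  qed
  finally show ?thesis by (simp add: m_def)
qed

lemma ln_ennreal_ge:
  assumes "R > 0" "ennreal R \<le> E"
  shows "ereal (ln R) \<le> ln_ennreal E"
proof (cases E)
  case (real x)
  then have "R \<le> x" "x > 0" using assms by (auto simp: ennreal_le_iff2)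
  then show ?thesis using real assms(1) by (simp add: ln_ennreal_def)
qed (use assms in \<open>auto simp: ln_ennreal_def\<close>)

theorem proposition2:
  fixes M :: "'a measure"
    and Q :: "real ^ 'n ^ 'n" and p xstar x0 xm1 :: "real ^ 'n"
    and r \<mu> L \<sigma> \<alpha> \<beta> \<gamma> \<theta> :: real
    and w :: "nat \<Rightarrow> 'a \<Rightarrow> real ^ 'n" and x :: "int \<Rightarrow> 'a \<Rightarrow> real ^ 'n"
  assumes "prob_space M"
    and "0 < \<mu>" and "\<mu> < L"
    and "transpose Q = Q"
    and "eigval Q 1 = \<mu>" and "eigval Q CARD('n) = L"
    and "is_arg_min (quad Q p r) (\<lambda>_. True) xstar"
    and "\<alpha> > 0" and "\<beta> \<ge> 0" and "\<gamma> \<ge> 0"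
    and "\<sigma> > 0" and "\<theta> > 0"
    and "noisy_gmm M (quad Q p r) \<alpha> \<beta> \<gamma> x0 xm1 w x"
    and "gaussian_noise M \<sigma> w x"
  shows "(\<bar>entropic_risk_inf M (quad Q p r) xstar \<sigma> x \<theta>\<bar> \<noteq> \<infinity> \<longleftrightarrow>
            (\<alpha>, \<beta>, \<gamma>) \<in> feasible_set Q \<theta>) \<and>
         (\<bar>entropic_risk_inf M (quad Q p r) xstar \<sigma> x \<theta>\<bar> \<noteq> \<infinity> \<longrightarrow>
            entropic_risk_inf M (quad Q p r) xstar \<sigma> x \<theta> =
              ereal (- (\<sigma>\<^sup>2 / \<theta>) * (\<Sum>i = 1..CARD('n). ln (1 - \<theta> / (2 * gmm_u Q \<alpha> \<beta> \<gamma> i)))))"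
proof -
  note sym = \<open>transpose Q = Q\<close> and \<alpha> = \<open>\<alpha> > 0\<close> and \<theta> = \<open>\<theta> > 0\<close> and \<sigma> = \<open>\<sigma> > 0\<close>
  obtain e :: "'n \<Rightarrow> real ^ 'n" and l :: "'n \<Rightarrow> real"
    where on: "\<And>i j. e i \<bullet> e j = (if i = j then 1 else 0)" and eig: "\<And>i. Q *v e i = l i *\<^sub>R e i"
    using symmetric_matrix_eigenbasis[OF sym] by blast
  have spec: "image_mset (eigval Q) (mset_set {1..CARD('n)}) = image_mset l (mset_set UNIV)"
    by (rule eigval_eigenbasis(1)[OF on eig])
  have l: "l i > 0" for i
    using eigval_eigenbasis(2)[OF on eig, of i] \<open>0 < \<mu>\<close> \<open>eigval Q 1 = \<mu>\<close> by simp

  define cc dd uu where "cc t = 1 + \<beta> - \<alpha> * (1 + \<gamma>) * t"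
    and "dd t = - (\<beta> - \<alpha> * \<gamma> * t)"
    and "uu t = (1 + dd t) * ((1 - dd t)\<^sup>2 - (cc t)\<^sup>2) / (t * (1 - dd t) * \<alpha>\<^sup>2)" for t
  have gmm_cdu: "gmm_c Q \<alpha> \<beta> \<gamma> i = cc (eigval Q i)" "gmm_d Q \<alpha> \<beta> \<gamma> i = dd (eigval Q i)"
    "gmm_u Q \<alpha> \<beta> \<gamma> i = uu (eigval Q i)" for i
    by (simp_all add: gmm_u_def gmm_c_def gmm_d_def cc_def dd_def uu_def)
  define \<rho> where "\<rho> i = \<theta> * l i * \<alpha>\<^sup>2 / 2" for i
  define vstat where "vstat i = stationary_variance (cc (l i)) (dd (l i))" for i
  define good where "good i \<longleftrightarrow> \<bar>dd (l i)\<bar> < 1 \<and> \<bar>cc (l i)\<bar> < 1 - dd (l i) \<and> \<rho> i * vstat i < 1" for i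
  have \<rho>: "\<rho> i > 0" for i using \<theta> l \<alpha> by (simp add: \<rho>_def)
  have feasible: "(\<alpha>, \<beta>, \<gamma>) \<in> feasible_set Q \<theta> \<longleftrightarrow> (\<forall>i. good i)"
  proof -
    have "(\<alpha>, \<beta>, \<gamma>) \<in> feasible_set Q \<theta> \<longleftrightarrow>
        (\<forall>i\<in>{1..CARD('n)}. \<bar>cc (eigval Q i)\<bar> < \<bar>1 - dd (eigval Q i)\<bar> \<and> \<theta> < 2 * uu (eigval Q i))"
      using \<alpha> \<open>\<beta> \<ge> 0\<close> \<open>\<gamma> \<ge> 0\<close> by (simp add: feasible_set_def gmm_cdu)
    also have "\<dots> \<longleftrightarrow> (\<forall>i\<in>UNIV. \<bar>cc (l i)\<bar> < \<bar>1 - dd (l i)\<bar> \<and> \<theta> < 2 * uu (l i))"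
      by (rule mset_image_Ball_iff[OF spec]) auto
    also have "\<dots> \<longleftrightarrow> (\<forall>i. good i)"
      using mode_feasible_iff(1)[OF l \<alpha> \<theta>] by (simp add: uu_def good_def \<rho>_def vstat_def)
    finally show ?thesis .
  qed
  have ratio: "\<rho> i * vstat i = \<theta> / (2 * uu (l i))" for i
    using mode_feasible_iff(2)[OF l \<alpha> \<theta>] by (simp add: uu_def \<rho>_def vstat_def)

  define S where "S i k = (\<Sum>j<k. (impulse (cc (l i)) (dd (l i)) (Suc j))\<^sup>2)" for i k
  define m where "m i k = impulse (cc (l i)) (dd (l i)) (Suc k) * (e i \<bullet> (x0 - xstar))
    + dd (l i) * impulse (cc (l i)) (dd (l i)) k * (e i \<bullet> (xm1 - xstar))" for i k
  define b where "b i = \<theta> * l i / (4 * \<sigma>\<^sup>2)" for i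
  have b: "b i \<ge> 0" for i using \<theta> l[of i] \<sigma> by (simp add: b_def)
  define E where "E k = (\<Prod>i\<in>UNIV. gaussian_square_mgf (\<rho> i * S i k) (b i) (m i k))" for k
  define risk where "risk = entropic_risk M (quad Q p r) xstar \<sigma> x \<theta>"
  have risk: "risk k = ereal (2 * \<sigma>\<^sup>2 / \<theta>) * ln_ennreal (E k)" if "k > 0" for k
    unfolding risk_def entropic_risk_def E_def
    using gmm_expectation_product[OF assms(1) sym on eig assms(7) \<alpha> \<sigma> that assms(13,14), of \<theta>]
    by (simp add: \<rho>_def S_def b_def m_def cc_def dd_def)
  have coef: "2 * \<sigma>\<^sup>2 / \<theta> > 0" using \<sigma> \<theta> by simp

  have infinite: "risk \<longlonglongrightarrow> \<infinity>" if bad: "\<not> good i0" for i0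
    unfolding tendsto_PInfty
  proof
    fix N :: real
    \<comment> \<open>Chosen so that an expectation of at least \<open>R\<close> gives a risk of at least \<open>N + 1\<close>.\<close>
    define R where "R = exp (\<theta> / (2 * \<sigma>\<^sup>2) * (N + 1))"
    have R: "R > 0" by (simp add: R_def)
    have "eventually (\<lambda>k. 1 - \<rho> i0 * S i0 k < 1 / R\<^sup>2) sequentially"
      unfolding S_def using R bad
      by (intro impulse_energy_reaches_threshold \<rho>) (auto simp: good_def vstat_def)
    then show "eventually (\<lambda>k. ereal N < risk k) sequentially"
      using eventually_gt_at_top[of 0]
    proof eventually_elim
      case (elim k)
      have "ennreal R \<le> gaussian_square_mgf (\<rho> i0 * S i0 k) (b i0) (m i0 k)"
        using elim b R by (intro gaussian_square_mgf_ge) auto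
      moreover have "1 \<le> (\<Prod>i\<in>UNIV - {i0}. gaussian_square_mgf (\<rho> i * S i k) (b i) (m i k))"
      proof (rule prod_ge_1)
        fix i
        have "0 \<le> \<rho> i * S i k" using \<rho>[of i] by (simp add: S_def sum_nonneg)
        then show "1 \<le> gaussian_square_mgf (\<rho> i * S i k) (b i) (m i k)"
          using gaussian_square_mgf_ge[of "b i" 1 "\<rho> i * S i k" "m i k"] b by simp
      qed
      ultimately have "ennreal R * 1 \<le> gaussian_square_mgf (\<rho> i0 * S i0 k) (b i0) (m i0 k)
          * (\<Prod>i\<in>UNIV - {i0}. gaussian_square_mgf (\<rho> i * S i k) (b i) (m i k))"
        by (rule mult_mono) auto
      then have "ennreal R \<le> E k"
        unfolding E_def by (subst prod.remove[of _ i0]) auto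
      then have "ereal (ln R) \<le> ln_ennreal (E k)" using R by (intro ln_ennreal_ge) auto
      then have "ereal (2 * \<sigma>\<^sup>2 / \<theta>) * ereal (ln R) \<le> risk k"
        unfolding risk[OF elim(2)] by (rule ereal_mult_left_mono) (use coef in simp)
      moreover have "2 * \<sigma>\<^sup>2 / \<theta> * ln R = N + 1" using \<sigma> \<theta> by (simp add: R_def)
      ultimately have "ereal (N + 1) \<le> risk k" by simp
      then show ?case by (rule less_le_trans[rotated]) simp
    qed
  qed

  have finite: "risk \<longlonglongrightarrow> ereal (- (\<sigma>\<^sup>2 / \<theta>) * (\<Sum>i = 1..CARD('n). ln (1 - \<theta> / (2 * gmm_u Q \<alpha> \<beta> \<gamma> i))))"
    if good: "\<forall>i. good i"
  proof -
    define H where "H i k = exp (b i * (m i k)\<^sup>2 / (1 - \<rho> i * S i k)) / sqrt (1 - \<rho> i * S i k)" for i k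
    have stable: "\<bar>dd (l i)\<bar> < 1" "\<bar>cc (l i)\<bar> < 1 - dd (l i)" and pos: "\<rho> i * vstat i < 1" for i
      using good by (auto simp: good_def)
    note sums = stable_imp_impulse_sums(1)[OF stable] and imp0 = stable_imp_impulse_sums(2)[OF stable]
    have limS: "S i \<longlonglongrightarrow> vstat i" for i
      using sums[of i] by (simp add: sums_def S_def[abs_def] vstat_def)
    have S_le: "S i k \<le> vstat i" for i k
      using sum_le_suminf[OF sums_summable[OF sums[of i]], of "{..<k}"] sums_unique[OF sums[of i]]
      by (simp add: S_def vstat_def)
    have lt: "\<rho> i * S i k < 1" for i k
      using mult_left_mono[OF S_le, of "\<rho> i" i k] \<rho>[of i] pos[of i] by linarith
    have limm: "m i \<longlonglongrightarrow> 0" for i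
    proof -
      have "m i \<longlonglongrightarrow> 0 * (e i \<bullet> (x0 - xstar)) + dd (l i) * 0 * (e i \<bullet> (xm1 - xstar))"
        unfolding m_def[abs_def] by (intro tendsto_intros LIMSEQ_Suc[OF imp0] imp0)
      then show ?thesis by simp
    qed
    have limH: "H i \<longlonglongrightarrow> 1 / sqrt (1 - \<rho> i * vstat i)" for i
    proof -
      have "H i \<longlonglongrightarrow> exp (b i * 0\<^sup>2 / (1 - \<rho> i * vstat i)) / sqrt (1 - \<rho> i * vstat i)"
        unfolding H_def[abs_def] using pos[of i] by (intro tendsto_intros limS limm) auto
      then show ?thesis by simp
    qed
    have H: "H i k > 0" for i k using lt[of i k] by (simp add: H_def)
    have E: "E k = ennreal (\<Prod>i\<in>UNIV. H i k)" for k
      using lt less_imp_le[OF H] by (simp add: E_def gaussian_square_mgf_def H_def prod_ennreal)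
    have ln: "ln_ennreal (E k) = ereal (ln (\<Prod>i\<in>UNIV. H i k))" for k
    proof -
      have "(\<Prod>i\<in>UNIV. H i k) > 0" by (intro prod_pos) (simp add: H)
      then show ?thesis by (simp add: ln_ennreal_def E del: prod_zero_iff)
    qed
    have prodpos: "(\<Prod>i\<in>UNIV. 1 / sqrt (1 - \<rho> i * vstat i)) > 0"
      using pos by (intro prod_pos) simp
    have "(\<lambda>k. ereal (2 * \<sigma>\<^sup>2 / \<theta> * ln (\<Prod>i\<in>UNIV. H i k)))
        \<longlonglongrightarrow> ereal (2 * \<sigma>\<^sup>2 / \<theta> * ln (\<Prod>i\<in>UNIV. 1 / sqrt (1 - \<rho> i * vstat i)))"
      by (intro tendsto_intros limH) (rule less_imp_neq[OF prodpos, symmetric])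
    moreover have "eventually (\<lambda>k. ereal (2 * \<sigma>\<^sup>2 / \<theta> * ln (\<Prod>i\<in>UNIV. H i k)) = risk k) sequentially"
      using eventually_gt_at_top[of 0] by eventually_elim (simp add: risk ln)
    ultimately have lim: "risk \<longlonglongrightarrow> ereal (2 * \<sigma>\<^sup>2 / \<theta> * ln (\<Prod>i\<in>UNIV. 1 / sqrt (1 - \<rho> i * vstat i)))"
      by (rule Lim_transform_eventually)
    have half: "ln (1 / sqrt q) = - (1 / 2) * ln q" if "q > 0" for q :: real
      using that by (simp add: ln_div ln_sqrt)
    have "ln (\<Prod>i\<in>UNIV. 1 / sqrt (1 - \<rho> i * vstat i)) = (\<Sum>i\<in>UNIV. ln (1 / sqrt (1 - \<rho> i * vstat i)))"
      using pos less_imp_neq[OF pos] by (intro ln_prod) simp_all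
    also have "\<dots> = (\<Sum>i\<in>UNIV. - (1 / 2) * ln (1 - \<theta> / (2 * uu (l i))))"
      using pos by (intro sum.cong refl) (subst half, simp_all add: ratio[symmetric])
    also have "\<dots> = (\<Sum>i = 1..CARD('n). - (1 / 2) * ln (1 - \<theta> / (2 * uu (eigval Q i))))"
      by (rule mset_image_sum_eq[OF spec, symmetric])
    also have "\<dots> = - (1 / 2) * (\<Sum>i = 1..CARD('n). ln (1 - \<theta> / (2 * gmm_u Q \<alpha> \<beta> \<gamma> i)))"
      by (simp only: sum_distrib_left gmm_cdu)
    finally show ?thesis using lim by simp
  qed

  have inf: "entropic_risk_inf M (quad Q p r) xstar \<sigma> x \<theta> = limsup risk"
    by (simp add: entropic_risk_inf_def risk_def)
  show ?thesis
  proof (cases "\<forall>i. good i")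
    case True
    then show ?thesis
      using lim_imp_Limsup[OF _ finite[OF True]] by (simp add: inf feasible)
  next
    case False
    then obtain i0 where "\<not> good i0" by blast
    then have "limsup risk = \<infinity>" by (intro lim_imp_Limsup infinite) auto
    then show ?thesis using False by (simp add: inf feasible)
  qed
qed

end
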